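(* Let $\rho$ be an admissible weight on $[0,+\infty[$, let $1\le p<+\infty$, let $X=L_p^\rho([0,+\infty[)$, and let $(T_t)_{t\ge 0}$ be the translation semigroup on $X$. Then $(T_t)_{t\ge 0}$ is chaotic if and only if it satisfies the Frequent Hypercyclicity Criterion for semigroups.
   Context: An admissible weight on $[0,+\infty[$ is a measurable function $\rho:[0,+\infty[\to\mathbb{R}$ such that $\rho(t)>0$ for all $t\ge0$ and there exist constants $M\ge1$, $\omega\in\mathbb{R}$ with $\rho(\tau)\le Me^{\omega t}\rho(\tau+t)$ for all $\tau\in[0,+\infty[$ and all $t>0$. $L_p^\rho([0,+\infty[)$ is the Banach space of (a.e. classes of) measurable functions $u:[0,+\infty[\to\mathbb{R}$ with $\|u\|_p=\left(\int_0^\infty|u(t)|^p\rho(t)\,dt\right)^{1/p}<\infty$. The translation semigroup is $T_tf(x)=f(x+t)$, $t\ge0$, $x\ge 0$; it is a $C_0$-semigroup on this space. A $C_0$-semigroup $(T_t)_{t\ge0}$ on a separable Banach space $X$ is hypercyclic if there is $x\in X$ such that $\{T_tx : t\ge0\}$ is dense in $X$. A point $x\in X$ is periodic for the semigroup if $T_tx=x$ for some $t>0$. The semigroup is chaotic if it is hypercyclic and its set of periodic points is dense in $X$. A $C_0$-semigroup $(T_t)_{t\ge0}$ on a separable Banach space $X$ satisfies the Frequent Hypercyclicity Criterion for semigroups if there exist a dense subset $X_0\subseteq X$ and maps $S_t:X_0\to X$, $t>0$ (not assumed linear or continuous), such that: (i) $T_tS_tx=x$ and $T_tS_rx=S_{r-t}x$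 for all $x\in X_0$, $t>0$, $r>t>0$; (ii) $t\mapsto T_tx$ is Pettis integrable on $[0,+\infty[$ for all $x\in X_0$; (iii) $t\mapsto S_tx$ is Pettis integrable on $[0,+\infty[$ for all $x\in X_0$. Here $f:[0,+\infty[\to X$ (possibly undefined at $0$) is Pettis integrable (with respect to Lebesgue measure $\mu$) if for every $\varphi\in X'$ (the topological dual) the function $\varphi\circ f$ is measurable and in $L^1([0,+\infty[)$, and for every measurable $E\subseteq[0,+\infty[$ there is $x_E\in X$ with $\varphi(x_E)=\int_E\varphi\circ f\,d\mu$ for all $\varphi\in X'$. *)

theory Defs
  imports "HOL-Analysis.Analysis"
begin

section \<open>Almost-everywhere classes of measurable functions on the half-line\<close>

text \<open>
  Functions on $[0,+\infty[$ are represented by functions on the reals whose values on the negative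
  half-line are ignored. The type below consists of the classes of Lebesgue measurable functions
  on the half-line modulo equality almost everywhere. It depends neither on the weight nor on
  the exponent, since a positive weight has the same null sets as Lebesgue measure.
\<close>

abbreviation halfline :: "real measure" where
  "halfline \<equiv> lebesgue_on {0..}"

definition ae_eq :: "(real \<Rightarrow> real) \<Rightarrow> (real \<Rightarrow> real) \<Rightarrow> bool" where
  "ae_eq f g \<longleftrightarrow> f \<in> borel_measurable halfline \<and> g \<in> borel_measurable halfline
     \<and> (AE t in halfline. f t = g t)"

lemma part_equivp_ae_eq: "part_equivp ae_eq"
proof (rule part_equivpI)
  show "\<exists>f. ae_eq f f"
    by (rule exI[of _ "\<lambda>_. 0"]) (simp add: ae_eq_def)
  show "symp ae_eq"
    by (auto simp: symp_def ae_eq_def elim: eventually_mono)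
  show "transp ae_eq"
    unfolding transp_def ae_eq_def by (auto elim: eventually_elim2)
qed

quotient_type ae_fun = "real \<Rightarrow> real" / partial: ae_eq
  by (rule part_equivp_ae_eq)

instantiation ae_fun :: real_vector
begin

lift_definition zero_ae_fun :: ae_fun is "\<lambda>_. 0"
  by (simp add: ae_eq_def)

lift_definition plus_ae_fun :: "ae_fun \<Rightarrow> ae_fun \<Rightarrow> ae_fun" is "\<lambda>f g t. f t + g t"
  by (auto simp: ae_eq_def elim: eventually_elim2)

lift_definition minus_ae_fun :: "ae_fun \<Rightarrow> ae_fun \<Rightarrow> ae_fun" is "\<lambda>f g t. f t - g t"
  by (auto simp: ae_eq_def elim: eventually_elim2)

lift_definition uminus_ae_fun :: "ae_fun \<Rightarrow> ae_fun" is "\<lambda>f t. - f t"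
  by (auto simp: ae_eq_def)

lift_definition scaleR_ae_fun :: "real \<Rightarrow> ae_fun \<Rightarrow> ae_fun" is "\<lambda>c f t. c * f t"
  by (auto simp: ae_eq_def elim: eventually_mono)

instance
proof
  fix a b c :: ae_fun and r q :: real
  show "a + b + c = a + (b + c)"
    by transfer (simp add: ae_eq_def algebra_simps)
  show "a + b = b + a"
    by transfer (simp add: ae_eq_def algebra_simps)
  show "0 + a = a" "1 *\<^sub>R a = a"
    by (transfer, simp add: ae_eq_def)+
  show "- a + a = 0" "a - b = a + - b"
    by (transfer, simp add: ae_eq_def)+
  show "r *\<^sub>R (a + b) = r *\<^sub>R a + r *\<^sub>R b"
    by transfer (simp add: ae_eq_def algebra_simps)
  show "(r + q) *\<^sub>R a = r *\<^sub>R a + q *\<^sub>R a"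
    by transfer (simp add: ae_eq_def algebra_simps)
  show "r *\<^sub>R q *\<^sub>R a = (r * q) *\<^sub>R a"
    by transfer (simp add: ae_eq_def algebra_simps)
qed

end

lemma translate_measurable:
  assumes "f \<in> borel_measurable halfline" and "0 \<le> s"
  shows "(\<lambda>t. f (t + s)) \<in> borel_measurable halfline"
proof -
  have "(\<lambda>t::real. t + s) \<in> lebesgue \<rightarrow>\<^sub>M lebesgue"
    using lebesgue_affine_measurable[of "\<lambda>_::real. 1::real" s] by (simp add: add.commute)
  then have "(\<lambda>t. t + s) \<in> halfline \<rightarrow>\<^sub>M halfline"
    using assms(2)
    by (intro measurable_restrict_space2 measurable_restrict_space1) auto
  then show ?thesis
    using assms(1) by (rule measurable_compose)
qed

lemma translate_AE:
  assumes "AE t in halfline. P t" and "0 \<le> s"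
  shows "AE t in halfline. P (t + s)"
proof -
  have A: "(AE t in halfline. Q t) \<longleftrightarrow> negligible {t. 0 \<le> t \<and> \<not> Q t}" for Q :: "real \<Rightarrow> bool"
    by (simp add: AE_restrict_space_iff completion.AE_iff_null_sets negligible_iff_null_sets)
  have "negligible ((+) (- s) ` {t. 0 \<le> t \<and> \<not> P t})"
    using assms(1) unfolding A by (rule negligible_translation)
  then show ?thesis
    unfolding A
  proof (rule negligible_subset, safe)
    fix t :: real
    assume "0 \<le> t" "\<not> P (t + s)"
    then show "t \<in> (+) (- s) ` {t. 0 \<le> t \<and> \<not> P t}"
      using assms(2) by (intro image_eqI[of _ _ "t + s"]) auto
  qed
qed

text \<open>
  The translation semigroup. Translation by a negative amount does not respect a.e. equality on
  the half-line, hence the \<^term>\<open>max 0 s\<close>; only \<^prop>\<open>s \<ge> 0\<close> is ever used.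
\<close>

lift_definition translation :: "real \<Rightarrow> ae_fun \<Rightarrow> ae_fun" is "\<lambda>s f x. f (x + max 0 s)"
  subgoal for s f g
    using translate_measurable[of f "max 0 s"] translate_measurable[of g "max 0 s"]
      translate_AE[of "\<lambda>t. f t = g t" "max 0 s"]
    by (simp add: ae_eq_def)
  done


section \<open>Weighted Lebesgue spaces on the half-line\<close>

definition admissible_weight :: "(real \<Rightarrow> real) \<Rightarrow> bool" where
  "admissible_weight \<rho> \<longleftrightarrow>
     \<rho> \<in> borel_measurable halfline \<and> (\<forall>t\<ge>0. \<rho> t > 0) \<and>
     (\<exists>M \<omega>. M \<ge> 1 \<and> (\<forall>\<tau>\<ge>0. \<forall>t>0. \<rho> \<tau> \<le> M * exp (\<omega> * t) * \<rho> (\<tau> + t)))"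

lemma measurable_halfline_AE:
  fixes f g :: "real \<Rightarrow> real"
  assumes "f \<in> borel_measurable halfline" and "AE t in halfline. f t = g t"
  shows "g \<in> borel_measurable halfline"
proof -
  let ?i = "\<lambda>f t. if t \<in> {0..} then f t else (0::real)"
  have "?i f \<in> borel_measurable lebesgue"
    using assms(1) by (subst borel_measurable_if) auto
  moreover have "AE t in lebesgue. ?i f t = ?i g t"
    using assms(2) by (auto simp: AE_restrict_space_iff elim!: eventually_mono)
  then have N: "{t. ?i f t \<noteq> ?i g t} \<in> null_sets lebesgue"
    by (simp add: completion.AE_iff_null_sets)
  moreover have "?i f \<in> borel_measurable (lebesgue_on (- {t. ?i f t \<noteq> ?i g t}))
      \<longleftrightarrow> ?i g \<in> borel_measurable (lebesgue_on (- {t. ?i f t \<noteq> ?i g t}))"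
    by (rule measurable_cong) simp
  ultimately have "?i g \<in> borel_measurable lebesgue"
    using lebesgue_measurable_diff_null[OF N] by blast
  then show ?thesis
    by (subst (asm) borel_measurable_if) auto
qed

lemma halfline_integral_cong:
  fixes f g :: "real \<Rightarrow> real"
  assumes "AE t in halfline. f t = g t"
  shows "integrable halfline f \<longleftrightarrow> integrable halfline g" and "integral\<^sup>L halfline f = integral\<^sup>L halfline g"
proof -
  have 1: "integrable halfline k" if "integrable halfline h" "AE t in halfline. h t = k t"
    for h k :: "real \<Rightarrow> real"
    by (rule integrable_cong_AE_imp[OF that(1) _ that(2)])
      (rule measurable_halfline_AE[OF borel_measurable_integrable[OF that(1)] that(2)])
  have sym: "AE t in halfline. g t = f t"
    using assms by eventually_elim simp
  show iff: "integrable halfline f \<longleftrightarrow> integrable halfline g"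
    using 1[OF _ assms] 1[OF _ sym] by blast
  show "integral\<^sup>L halfline f = integral\<^sup>L halfline g"
  proof (cases "integrable halfline f")
    case True
    then show ?thesis
      using iff assms by (intro integral_cong_AE borel_measurable_integrable) auto
  next
    case False
    then show ?thesis
      using iff by (simp add: not_integrable_integral_eq)
  qed
qed

lemma ae_eq_integrand:
  assumes "ae_eq f g"
  shows "AE t in halfline. \<bar>f t\<bar> powr p * \<rho> t = \<bar>g t\<bar> powr p * \<rho> t"
proof -
  have "AE t in halfline. f t = g t"
    using assms by (simp add: ae_eq_def)
  then show ?thesis
    by eventually_elim simp
qed

lift_definition Lp_finite :: "real \<Rightarrow> (real \<Rightarrow> real) \<Rightarrow> ae_fun \<Rightarrow> bool" is
  "\<lambda>p \<rho> u. integrable halfline (\<lambda>t. \<bar>u t\<bar> powr p * \<rho> t)"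
  by (rule halfline_integral_cong(1), rule ae_eq_integrand)

definition Lp :: "real \<Rightarrow> (real \<Rightarrow> real) \<Rightarrow> ae_fun set" where
  "Lp p \<rho> = {u. Lp_finite p \<rho> u}"

lift_definition Lp_norm :: "real \<Rightarrow> (real \<Rightarrow> real) \<Rightarrow> ae_fun \<Rightarrow> real" is
  "\<lambda>p \<rho> u. (\<integral>t. \<bar>u t\<bar> powr p * \<rho> t \<partial>halfline) powr (1 / p)"
  by (rule arg_cong[where f = "\<lambda>x. x powr _"], rule halfline_integral_cong(2),
      rule ae_eq_integrand)

lemma powr_abs_add_le:
  fixes x y a b p :: real
  assumes "1 \<le> p" "0 < a" "0 < b"
  shows "\<bar>x + y\<bar> powr p
    \<le> (a + b) powr p * (a / (a + b) * (\<bar>x\<bar> / a) powr p + b / (a + b) * (\<bar>y\<bar> / b) powr p)"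
proof -
  define c where "c = a / (a + b)"
  have c: "0 < c" "c < 1" "1 - c = b / (a + b)"
    using assms by (auto simp: c_def field_simps)
  have conv: "(c * u + (1 - c) * v) powr p \<le> c * u powr p + (1 - c) * v powr p"
    if "0 \<le> u" "0 \<le> v" for u v :: real
  proof -
    have small: "(d * w) powr p \<le> d * w powr p" if "0 < d" "d < 1" "0 \<le> w" for d w :: real
    proof -
      have "d powr p \<le> d powr 1"
        using that assms(1) by (intro powr_mono') auto
      then show ?thesis
        using that by (simp add: powr_mult mult_right_mono)
    qed
    show ?thesis
    proof (cases "u = 0 \<or> v = 0")
      case True
      then show ?thesis
        using small[of c u] small[of "1 - c" v] c that by auto
    next
      case False
      then have "u \<in> {0<..}" "v \<in> {0<..}"
        using that by auto
      then show ?thesis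
        using convex_onD[OF powr_convex[OF assms(1)], of "1 - c" u v] c(1,2) by auto
    qed
  qed
  have "\<bar>x + y\<bar> \<le> (a + b) * (c * (\<bar>x\<bar> / a) + (1 - c) * (\<bar>y\<bar> / b))"
  proof -
    have "(a + b) * (c * (\<bar>x\<bar> / a)) = \<bar>x\<bar>" "(a + b) * ((1 - c) * (\<bar>y\<bar> / b)) = \<bar>y\<bar>"
      unfolding c(3) using assms by (simp_all add: c_def)
    then show ?thesis
      by (simp only: distrib_left abs_triangle_ineq)
  qed
  then have "\<bar>x + y\<bar> powr p \<le> ((a + b) * (c * (\<bar>x\<bar> / a) + (1 - c) * (\<bar>y\<bar> / b))) powr p"
    using assms(1) by (intro powr_mono2) auto
  also have "\<dots> = (a + b) powr p * (c * (\<bar>x\<bar> / a) + (1 - c) * (\<bar>y\<bar> / b)) powr p"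
    by (rule powr_mult)
  also have "\<dots> \<le> (a + b) powr p * (c * (\<bar>x\<bar> / a) powr p + (1 - c) * (\<bar>y\<bar> / b) powr p)"
    using assms by (intro mult_left_mono conv) auto
  finally show ?thesis
    unfolding c(3) unfolding c_def .
qed

context
  fixes \<rho> :: "real \<Rightarrow> real" and p :: real
  assumes weight: "\<rho> \<in> borel_measurable halfline" "\<forall>t\<ge>0. \<rho> t > 0" and p: "1 \<le> p"
begin

lemma Lp_add:
  assumes "u \<in> Lp p \<rho>" "v \<in> Lp p \<rho>"
  shows "u + v \<in> Lp p \<rho>"
    and "0 < a \<Longrightarrow> 0 < b \<Longrightarrow> Lp_norm p \<rho> u \<le> a \<Longrightarrow> Lp_norm p \<rho> v \<le> b \<Longrightarrow>
      Lp_norm p \<rho> (u + v) \<le> a + b"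
proof -
  define I where "I f = (\<integral>t. \<bar>f t\<bar> powr p * \<rho> t \<partial>halfline)" for f :: "real \<Rightarrow> real"
  have *: "integrable halfline (\<lambda>t. \<bar>f t + g t\<bar> powr p * \<rho> t) \<and>
     (0 < a \<longrightarrow> 0 < b \<longrightarrow> I f powr (1 / p) \<le> a \<longrightarrow> I g powr (1 / p) \<le> b \<longrightarrow>
       I (\<lambda>t. f t + g t) powr (1 / p) \<le> a + b)"
    if fg: "f \<in> borel_measurable halfline" "g \<in> borel_measurable halfline"
      "integrable halfline (\<lambda>t. \<bar>f t\<bar> powr p * \<rho> t)" "integrable halfline (\<lambda>t. \<bar>g t\<bar> powr p * \<rho> t)"
    for f g :: "real \<Rightarrow> real" and a b
  proof -
    define h where "h a b t = (a + b) powr p * (a / (a + b) * (\<bar>f t\<bar> / a) powr p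
      + b / (a + b) * (\<bar>g t\<bar> / b) powr p) * \<rho> t" for a b t
    define A where "A a b = (a + b) powr p * a / ((a + b) * a powr p)" for a b :: real
    have h: "h a b t = A a b * (\<bar>f t\<bar> powr p * \<rho> t) + A b a * (\<bar>g t\<bar> powr p * \<rho> t)"
      if "0 < a" "0 < b" for a b t
      using that by (simp add: h_def A_def powr_divide field_simps)
    have le: "\<bar>f t + g t\<bar> powr p * \<rho> t \<le> h a b t" if "0 < a" "0 < b" "0 \<le> t" for a b t
      unfolding h_def using that weight(2) p
      by (intro mult_right_mono powr_abs_add_le) (auto intro: less_imp_le)
    have int_h: "integrable halfline (h a b)" if "0 < a" "0 < b" for a b
      using h[OF that] fg by (simp add: cong: Bochner_Integration.integrable_cong)
    have int: "integrable halfline (\<lambda>t. \<bar>f t + g t\<bar> powr p * \<rho> t)"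
    proof (rule Bochner_Integration.integrable_bound[OF int_h[of 1 1]])
      show "(\<lambda>t. \<bar>f t + g t\<bar> powr p * \<rho> t) \<in> borel_measurable halfline"
        using fg weight(1) by measurable
      show "AE t in halfline. norm (\<bar>f t + g t\<bar> powr p * \<rho> t) \<le> norm (h 1 1 t)"
      proof (rule AE_I2)
        fix t :: real
        assume "t \<in> space halfline"
        then have "0 \<le> t" by simp
        then have "0 \<le> \<bar>f t + g t\<bar> powr p * \<rho> t"
          using weight(2) by (simp add: less_imp_le)
        then show "norm (\<bar>f t + g t\<bar> powr p * \<rho> t) \<le> norm (h 1 1 t)"
          using le[of 1 1 t] \<open>0 \<le> t\<close> by simp
      qed
    qed auto
    have I_nonneg: "0 \<le> I f" for f
      unfolding I_def using weight(2) by (intro integral_nonneg_AE AE_I2) (auto simp: less_imp_le)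
    have "I (\<lambda>t. f t + g t) powr (1 / p) \<le> a + b"
      if ab: "0 < a" "0 < b" "I f powr (1 / p) \<le> a" "I g powr (1 / p) \<le> b"
    proof -
      have root: "x \<le> c powr p" if "x powr (1 / p) \<le> c" "0 \<le> x" for x c :: real
      proof -
        have "(x powr (1 / p)) powr p \<le> c powr p"
          using that p by (intro powr_mono2) auto
        then show ?thesis using that p by (simp add: powr_powr)
      qed
      have "I (\<lambda>t. f t + g t) \<le> integral\<^sup>L halfline (h a b)"
        unfolding I_def using le ab int int_h by (intro integral_mono) auto
      also have "\<dots> = A a b * I f + A b a * I g"
        using fg ab by (simp add: h I_def cong: Bochner_Integration.integral_cong)
      also have "\<dots> \<le> A a b * a powr p + A b a * b powr p"
        using ab I_nonneg by (intro add_mono mult_left_mono root) (auto simp: A_def)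
      also have "\<dots> = (a + b) powr p"
      proof -
        have "A a b * a powr p = (a + b) powr p * (a / (a + b))"
          "A b a * b powr p = (a + b) powr p * (b / (a + b))"
          using ab by (auto simp: A_def add.commute)
        then have "A a b * a powr p + A b a * b powr p = (a + b) powr p * ((a + b) / (a + b))"
          by (simp only: add_divide_distrib distrib_left)
        then show ?thesis using ab by simp
      qed
      finally have "I (\<lambda>t. f t + g t) powr (1 / p) \<le> ((a + b) powr p) powr (1 / p)"
        using p I_nonneg by (intro powr_mono2) auto
      then show ?thesis using ab p by (simp add: powr_powr)
    qed
    with int show ?thesis by blast
  qed
  show "u + v \<in> Lp p \<rho>"
    using assms unfolding Lp_def mem_Collect_eq
    by (transfer fixing: p \<rho>) (use * in \<open>simp add: ae_eq_def\<close>)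
  show "Lp_norm p \<rho> (u + v) \<le> a + b"
    if "0 < a" "0 < b" "Lp_norm p \<rho> u \<le> a" "Lp_norm p \<rho> v \<le> b"
    using assms that unfolding Lp_def mem_Collect_eq
    by (transfer fixing: p \<rho> a b) (use * in \<open>simp add: ae_eq_def I_def\<close>)
qed

lemma Lp_norm_nonneg: "0 \<le> Lp_norm p \<rho> u"
  by (transfer fixing: p \<rho>) simp

lemma Lp_norm_triangle:
  assumes "u \<in> Lp p \<rho>" "v \<in> Lp p \<rho>"
  shows "Lp_norm p \<rho> (u + v) \<le> Lp_norm p \<rho> u + Lp_norm p \<rho> v"
proof (rule field_le_epsilon)
  fix e :: real assume "0 < e"
  then show "Lp_norm p \<rho> (u + v) \<le> Lp_norm p \<rho> u + Lp_norm p \<rho> v + e"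
    using Lp_add(2)[OF assms, of "Lp_norm p \<rho> u + e / 2" "Lp_norm p \<rho> v + e / 2"]
      Lp_norm_nonneg[of u] Lp_norm_nonneg[of v] by simp
qed

lemma Lp_scaleR:
  assumes "u \<in> Lp p \<rho>"
  shows "c *\<^sub>R u \<in> Lp p \<rho>" and "Lp_norm p \<rho> (c *\<^sub>R u) = \<bar>c\<bar> * Lp_norm p \<rho> u"
proof -
  have *: "(\<lambda>t. \<bar>c * f t\<bar> powr p * \<rho> t) = (\<lambda>t. \<bar>c\<bar> powr p * (\<bar>f t\<bar> powr p * \<rho> t))" for f :: "real \<Rightarrow> real"
    by (simp add: abs_mult powr_mult mult.assoc)
  show "c *\<^sub>R u \<in> Lp p \<rho>"
    using assms unfolding Lp_def mem_Collect_eq by (transfer fixing: p \<rho> c) (simp add: *)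
  have "0 \<le> (\<integral>t. \<bar>f t\<bar> powr p * \<rho> t \<partial>halfline)" for f :: "real \<Rightarrow> real"
    using weight(2) by (intro integral_nonneg_AE AE_I2) (auto simp: less_imp_le)
  then show "Lp_norm p \<rho> (c *\<^sub>R u) = \<bar>c\<bar> * Lp_norm p \<rho> u"
    using p by (transfer fixing: p \<rho> c) (simp add: * powr_mult powr_powr)
qed

lemma zero_in_Lp: "0 \<in> Lp p \<rho>"
  unfolding Lp_def mem_Collect_eq by (transfer fixing: p \<rho>) simp

lemma Lp_norm_eq_0_iff:
  assumes "u \<in> Lp p \<rho>"
  shows "Lp_norm p \<rho> u = 0 \<longleftrightarrow> u = 0"
proof -
  have "(\<integral>t. \<bar>f t\<bar> powr p * \<rho> t \<partial>halfline) = 0 \<longleftrightarrow> (AE t in halfline. f t = 0)"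
    if "integrable halfline (\<lambda>t. \<bar>f t\<bar> powr p * \<rho> t)" for f
  proof -
    have "(\<integral>t. \<bar>f t\<bar> powr p * \<rho> t \<partial>halfline) = 0
        \<longleftrightarrow> (AE t in halfline. \<bar>f t\<bar> powr p * \<rho> t = 0)"
      using that weight(2) by (intro integral_nonneg_eq_0_iff_AE AE_I2) (auto simp: less_imp_le)
    also have "\<dots> \<longleftrightarrow> (AE t in halfline. f t = 0)"
      using weight(2) by (intro AE_cong) (auto dest: spec)
    finally show ?thesis .
  qed
  then show ?thesis
    using assms unfolding Lp_def mem_Collect_eq by (transfer fixing: p \<rho>) (simp add: ae_eq_def)
qed

lemma subspace_Lp: "subspace (Lp p \<rho>)"
  using zero_in_Lp Lp_add(1) Lp_scaleR(1) by (auto simp: subspace_def)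

lemma Metric_space_Lp: "Metric_space (Lp p \<rho>) (\<lambda>u v. Lp_norm p \<rho> (u - v))"
proof
  fix u v w
  show "0 \<le> Lp_norm p \<rho> (u - v)"
    by (rule Lp_norm_nonneg)
  show "Lp_norm p \<rho> (u - v) = Lp_norm p \<rho> (v - u)"
    by (transfer fixing: p \<rho>) (simp add: abs_minus_commute)
  assume uv: "u \<in> Lp p \<rho>" "v \<in> Lp p \<rho>"
  show "Lp_norm p \<rho> (u - v) = 0 \<longleftrightarrow> u = v"
    using Lp_norm_eq_0_iff subspace_diff[OF subspace_Lp uv] by simp
  assume "w \<in> Lp p \<rho>"
  then show "Lp_norm p \<rho> (u - w) \<le> Lp_norm p \<rho> (u - v) + Lp_norm p \<rho> (v - w)"
    using Lp_norm_triangle[of "u - v" "v - w"] subspace_diff[OF subspace_Lp] uv by simp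
qed

end

lemma integrable_translate:
  fixes h :: "real \<Rightarrow> real"
  assumes "integrable halfline h" and "0 \<le> s"
  shows "integrable halfline (\<lambda>t. h (t + s))"
proof -
  let ?h = "\<lambda>t. indicator {0..} t *\<^sub>R h t"
  have "lebesgue = density (distr lebesgue lebesgue (\<lambda>x. s + 1 * x)) (\<lambda>_. ennreal \<bar>1::real\<bar>)"
    by (rule lebesgue_real_affine) simp
  then have L: "lebesgue = distr lebesgue lebesgue (\<lambda>x. s + x)"
    by (simp add: density_1)
  have M: "(\<lambda>x::real. s + x) \<in> lebesgue \<rightarrow>\<^sub>M lebesgue"
    using lebesgue_affine_measurable[of "\<lambda>_::real. 1::real" s] by simp
  have h: "integrable lebesgue ?h"
    using assms(1) by (simp add: integrable_restrict_space)
  then have "integrable (distr lebesgue lebesgue (\<lambda>x. s + x)) ?h"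
    by (subst L[symmetric])
  then have "integrable lebesgue (\<lambda>t. ?h (s + t))"
    using integrable_distr_eq[OF M borel_measurable_integrable[OF h]] by blast
  then have "integrable lebesgue (\<lambda>t. indicator {0..} t *\<^sub>R ?h (s + t))"
    by (intro integrable_mult_indicator) auto
  moreover have "(\<lambda>t. indicator {0..} t *\<^sub>R ?h (s + t)) = (\<lambda>t. indicator {0..} t *\<^sub>R h (t + s))"
    using assms(2) by (auto simp: indicator_def add.commute)
  ultimately have "integrable lebesgue (\<lambda>t. indicator {0..} t *\<^sub>R h (t + s))"
    by (simp only:)
  then show ?thesis
    by (simp add: integrable_restrict_space)
qed

lemma translation_in_Lp:
  assumes \<rho>: "admissible_weight \<rho>" and u: "u \<in> Lp p \<rho>" and s: "0 \<le> s"
  shows "translation s u \<in> Lp p \<rho>"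
proof (cases "s = 0")
  case True
  then show ?thesis
    using u unfolding Lp_def mem_Collect_eq by (transfer fixing: p \<rho> s) simp
next
  case False
  from \<rho> obtain M \<omega> where M: "\<rho> \<tau> \<le> M * exp (\<omega> * t) * \<rho> (\<tau> + t)" if "0 \<le> \<tau>" "0 < t" for \<tau> t
    unfolding admissible_weight_def by blast
  have pos: "0 < \<rho> t" if "0 \<le> t" for t
    using \<rho> that by (simp add: admissible_weight_def)
  have "integrable halfline (\<lambda>t. \<bar>f (t + s)\<bar> powr p * \<rho> t)"
    if f: "f \<in> borel_measurable halfline" "integrable halfline (\<lambda>t. \<bar>f t\<bar> powr p * \<rho> t)" for f
  proof (rule Bochner_Integration.integrable_bound)
    show "integrable halfline (\<lambda>t. (M * exp (\<omega> * s)) * (\<bar>f (t + s)\<bar> powr p * \<rho> (t + s)))"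
      by (rule integrable_mult_right) (rule integrable_translate[OF f(2) s])
    show "(\<lambda>t. \<bar>f (t + s)\<bar> powr p * \<rho> t) \<in> borel_measurable halfline"
    proof -
      have "\<rho> \<in> borel_measurable halfline"
        using \<rho> by (simp add: admissible_weight_def)
      then show ?thesis
        using translate_measurable[OF f(1) s] by measurable
    qed
    show "AE t in halfline. norm (\<bar>f (t + s)\<bar> powr p * \<rho> t)
        \<le> norm ((M * exp (\<omega> * s)) * (\<bar>f (t + s)\<bar> powr p * \<rho> (t + s)))"
    proof (rule AE_I2)
      fix t :: real
      assume "t \<in> space halfline"
      then have t: "0 \<le> t" by simp
      have "\<bar>f (t + s)\<bar> powr p * \<rho> t
          \<le> \<bar>f (t + s)\<bar> powr p * (M * exp (\<omega> * s) * \<rho> (t + s))"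
        using M[of t s] t s False by (intro mult_left_mono) auto
      moreover have "0 \<le> \<bar>f (t + s)\<bar> powr p * \<rho> t"
        using pos[OF t] by simp
      ultimately show "norm (\<bar>f (t + s)\<bar> powr p * \<rho> t)
          \<le> norm ((M * exp (\<omega> * s)) * (\<bar>f (t + s)\<bar> powr p * \<rho> (t + s)))"
        unfolding real_norm_def
        by (simp only: mult.left_commute[of "M * exp (\<omega> * s)"])
    qed
  qed
  then show ?thesis
    using u s unfolding Lp_def mem_Collect_eq
    by (transfer fixing: p \<rho> s) (simp add: ae_eq_def)
qed


section \<open>Dynamics of operator families on a normed space\<close>

text \<open>
  A normed space is given by a linear subspace \<open>V\<close> of a real vector space together with a norm
  \<open>N\<close> on \<open>V\<close>.
\<close>

definition norm_topology :: "'a::real_vector set \<Rightarrow> ('a \<Rightarrow> real) \<Rightarrow> 'a topology" where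
  "norm_topology V N = Metric_space.mtopology V (\<lambda>x y. N (x - y))"

definition dense_subset :: "'a::real_vector set \<Rightarrow> ('a \<Rightarrow> real) \<Rightarrow> 'a set \<Rightarrow> bool" where
  "dense_subset V N A \<longleftrightarrow> A \<subseteq> V \<and> norm_topology V N closure_of A = V"

text \<open>The values outside \<open>V\<close> of a functional in the topological dual are irrelevant.\<close>

definition dual_space :: "'a::real_vector set \<Rightarrow> ('a \<Rightarrow> real) \<Rightarrow> ('a \<Rightarrow> real) set" where
  "dual_space V N = {\<phi>. (\<forall>x\<in>V. \<forall>y\<in>V. \<phi> (x + y) = \<phi> x + \<phi> y) \<and>
     (\<forall>c. \<forall>x\<in>V. \<phi> (c *\<^sub>R x) = c * \<phi> x) \<and>
     continuous_map (norm_topology V N) euclideanreal \<phi>}"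

text \<open>The function may be undefined at \<open>0\<close>, i.e. \<open>f 0\<close> need not belong to \<open>V\<close>.\<close>

definition Pettis_integrable ::
    "'a::real_vector set \<Rightarrow> ('a \<Rightarrow> real) \<Rightarrow> (real \<Rightarrow> 'a) \<Rightarrow> bool" where
  "Pettis_integrable V N f \<longleftrightarrow>
     (\<forall>t>0. f t \<in> V) \<and>
     (\<forall>\<phi>\<in>dual_space V N. integrable halfline (\<lambda>t. \<phi> (f t))) \<and>
     (\<forall>E\<in>sets lebesgue. E \<subseteq> {0..} \<longrightarrow>
        (\<exists>x\<in>V. \<forall>\<phi>\<in>dual_space V N. \<phi> x = (\<integral>t. \<phi> (f t) \<partial>lebesgue_on E)))"

definition hypercyclic ::
    "'a::real_vector set \<Rightarrow> ('a \<Rightarrow> real) \<Rightarrow> (real \<Rightarrow> 'a \<Rightarrow> 'a) \<Rightarrow> bool" where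
  "hypercyclic V N T \<longleftrightarrow> (\<exists>x\<in>V. dense_subset V N {T t x |t. t \<ge> 0})"

definition periodic_points :: "'a set \<Rightarrow> (real \<Rightarrow> 'a \<Rightarrow> 'a) \<Rightarrow> 'a set" where
  "periodic_points V T = {x \<in> V. \<exists>t>0. T t x = x}"

definition chaotic ::
    "'a::real_vector set \<Rightarrow> ('a \<Rightarrow> real) \<Rightarrow> (real \<Rightarrow> 'a \<Rightarrow> 'a) \<Rightarrow> bool" where
  "chaotic V N T \<longleftrightarrow> hypercyclic V N T \<and> dense_subset V N (periodic_points V T)"

definition frequent_hypercyclicity_criterion ::
    "'a::real_vector set \<Rightarrow> ('a \<Rightarrow> real) \<Rightarrow> (real \<Rightarrow> 'a \<Rightarrow> 'a) \<Rightarrow> bool" where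
  "frequent_hypercyclicity_criterion V N T \<longleftrightarrow>
     (\<exists>X0 S. dense_subset V N X0 \<and>
        (\<forall>t>0. \<forall>x\<in>X0. S t x \<in> V) \<and>
        (\<forall>x\<in>X0. \<forall>t>0. T t (S t x) = x) \<and>
        (\<forall>x\<in>X0. \<forall>t>0. \<forall>r>t. T t (S r x) = S (r - t) x) \<and>
        (\<forall>x\<in>X0. Pettis_integrable V N (\<lambda>t. T t x)) \<and>
        (\<forall>x\<in>X0. Pettis_integrable V N (\<lambda>t. S t x)))"

end

theory Submission
  imports Defs
begin

text \<open>
  Both properties are equivalent to the integrability of the weight \<open>\<rho>\<close> on the half-line, and each
  implication goes through that condition.

  Suppose first that \<open>u \<noteq> 0\<close> is an element of the space whose shape repeats with some period \<open>s\<close>. By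
  admissibility \<open>\<rho> y\<close> is bounded by a constant times \<open>\<rho> x\<close> for all \<open>x\<close> in a window of fixed length
  that starts at \<open>y\<close>, and \<open>\<bar>u\<bar>\<^sup>p\<close> has at least a fixed mass in each window. So \<open>\<integral> \<rho>\<close> is at most a
  constant times \<open>\<integral> \<bar>u\<bar>\<^sup>p \<rho>\<close>, which is finite (\<open>integrable_weight_if_periodic_windows\<close>). A chaotic
  semigroup has such an element, since its periodic points are dense. Under the Frequent
  Hypercyclicity Criterion the maps \<open>S\<^sub>t\<close> extend the orbit of a point \<open>x\<close> to negative times, and
  Pettis integrability allows the extended orbit to be integrated over a periodic set of times.
  The result is periodic. It is not zero if the set of times consists of short intervals that are
  far apart, because only the interval that starts at time \<open>0\<close> then contributes noticeably. Both facts
  are read off from the functionals \<open>u \<mapsto> \<integral>\<^sub>a\<^sup>b u\<close>.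

  Suppose conversely that \<open>\<rho>\<close> is integrable. Then every bounded measurable function belongs to the
  space, and bounded pointwise convergence implies convergence in norm. For the criterion, \<open>X\<^sub>0\<close>
  consists of continuous functions \<open>f\<close> with compact support that vanish on the negative half-line,
  and \<open>S\<^sub>t\<close> is translation to the right. The Pettis integrals are the pointwise integrals
  \<open>x \<mapsto> \<integral>\<^sub>E f (x \<plusminus> t) dt\<close>, which are bounded by \<open>\<integral> \<bar>f\<bar>\<close>; that they commute with functionals follows
  from Riemann sums, without a description of the dual (\<open>Pettis_integrable_kernel\<close>). For chaos, the
  periodic continuation of a function cut off at a large period converges to it boundedly, and a
  vector with dense orbit is glued from a sequence of step functions with rational values, placed
  so far apart that each of them is, at its turn, nearly all that the orbit sees
  (\<open>hypercyclic_if_dense_blocks\<close>).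
\<close>

section \<open>Weighted Lebesgue spaces through representatives\<close>

lemma ae_eq_refl_iff: "ae_eq f f \<longleftrightarrow> f \<in> borel_measurable halfline"
  by (simp add: ae_eq_def)

lemma ae_fun_cases:
  obtains f where "f \<in> borel_measurable halfline" and "u = abs_ae_fun f"
proof -
  have "ae_eq (rep_ae_fun u) (rep_ae_fun u)" "abs_ae_fun (rep_ae_fun u) = u"
    using Quotient_rep_reflp[OF Quotient_ae_fun] Quotient_abs_rep[OF Quotient_ae_fun] by auto
  then show thesis
    using that[of "rep_ae_fun u"] by (simp add: ae_eq_refl_iff)
qed

lemma abs_ae_fun_linear:
  assumes "f \<in> borel_measurable halfline" "g \<in> borel_measurable halfline"
  shows "abs_ae_fun f + abs_ae_fun g = abs_ae_fun (\<lambda>t. f t + g t)"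
    and "abs_ae_fun f - abs_ae_fun g = abs_ae_fun (\<lambda>t. f t - g t)"
  using assms
  by (simp_all add: plus_ae_fun.abs_eq minus_ae_fun.abs_eq ae_eq_refl_iff)

lemma abs_ae_fun_scaleR:
  assumes "f \<in> borel_measurable halfline"
  shows "c *\<^sub>R abs_ae_fun f = abs_ae_fun (\<lambda>t. c * f t)"
  using assms by (simp add: scaleR_ae_fun.abs_eq ae_eq_refl_iff)

lemma zero_ae_fun_abs: "0 = abs_ae_fun (\<lambda>_. 0)"
  by (simp add: zero_ae_fun.abs_eq)

lemma abs_ae_fun_sum:
  assumes "finite I" and "\<And>i. i \<in> I \<Longrightarrow> f i \<in> borel_measurable halfline"
  shows "(\<Sum>i\<in>I. c i *\<^sub>R abs_ae_fun (f i)) = abs_ae_fun (\<lambda>t. \<Sum>i\<in>I. c i * f i t)"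
  using assms
proof (induction I rule: finite_induct)
  case empty
  then show ?case by (simp add: zero_ae_fun_abs)
next
  case (insert i I)
  then have "(\<lambda>t. c i * f i t) \<in> borel_measurable halfline"
    "(\<lambda>t. \<Sum>i\<in>I. c i * f i t) \<in> borel_measurable halfline"
    by (auto intro!: borel_measurable_sum borel_measurable_times)
  then show ?case
    using insert by (simp add: abs_ae_fun_linear abs_ae_fun_scaleR)
qed

lemma translation_abs:
  assumes "f \<in> borel_measurable halfline" "0 \<le> s"
  shows "translation s (abs_ae_fun f) = abs_ae_fun (\<lambda>x. f (x + s))"
  using assms by (simp add: translation.abs_eq ae_eq_refl_iff)

lemma Lp_abs_iff:
  assumes "f \<in> borel_measurable halfline"
  shows "abs_ae_fun f \<in> Lp p \<rho> \<longleftrightarrow> integrable halfline (\<lambda>t. \<bar>f t\<bar> powr p * \<rho> t)"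
  using assms by (simp add: Lp_def Lp_finite.abs_eq ae_eq_refl_iff)

lemma Lp_norm_abs:
  assumes "f \<in> borel_measurable halfline"
  shows "Lp_norm p \<rho> (abs_ae_fun f) = (\<integral>t. \<bar>f t\<bar> powr p * \<rho> t \<partial>halfline) powr (1 / p)"
  using assms by (simp add: Lp_norm.abs_eq ae_eq_refl_iff)

text \<open>
  The local integral \<open>\<integral>\<^sub>a\<^sup>b u\<close> is a functional that interacts with translation only through
  its endpoints, which makes it a test for periodicity.
\<close>

lift_definition window_integral :: "real \<Rightarrow> real \<Rightarrow> ae_fun \<Rightarrow> real" is
  "\<lambda>a b f. \<integral>t. indicator {a..b} t * f t \<partial>halfline"
  by (rule halfline_integral_cong(2)) (auto simp: ae_eq_def elim: eventually_mono)

lemma window_integral_abs: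
  assumes "f \<in> borel_measurable halfline"
  shows "window_integral a b (abs_ae_fun f) = (\<integral>t. indicator {a..b} t * f t \<partial>halfline)"
  using assms by (simp add: window_integral.abs_eq ae_eq_refl_iff)

text \<open>Translations and the reflection of the line preserve Lebesgue measure.\<close>

lemma integral_lebesgue_affine:
  fixes h :: "real \<Rightarrow> real"
  assumes "h \<in> borel_measurable lebesgue" and "\<bar>c\<bar> = 1"
  shows "integrable lebesgue (\<lambda>t. h (s + c * t)) \<longleftrightarrow> integrable lebesgue h"
    and "(\<integral>t. h (s + c * t) \<partial>lebesgue) = integral\<^sup>L lebesgue h"
proof -
  have c: "c \<noteq> 0" using assms(2) by auto
  have "lebesgue = density (distr lebesgue lebesgue (\<lambda>x. s + c * x)) (\<lambda>_. ennreal \<bar>c::real\<bar>)"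
    by (rule lebesgue_real_affine) fact
  then have L: "lebesgue = distr lebesgue lebesgue (\<lambda>x. s + c * x)"
    using assms(2) by (simp add: density_1)
  have M: "(\<lambda>x::real. s + c * x) \<in> lebesgue \<rightarrow>\<^sub>M lebesgue"
    using lebesgue_affine_measurable[of "\<lambda>_::real. c" s] c by simp
  show "integrable lebesgue (\<lambda>t. h (s + c * t)) \<longleftrightarrow> integrable lebesgue h"
    by (subst (2) L, rule integrable_distr_eq[OF M assms(1), symmetric])
  show "(\<integral>t. h (s + c * t) \<partial>lebesgue) = integral\<^sup>L lebesgue h"
    by (subst (2) L, rule integral_distr[OF M assms(1), symmetric])
qed

lemma halfline_borel_measurable_iff:
  fixes f :: "real \<Rightarrow> real"
  shows "f \<in> borel_measurable halfline \<longleftrightarrow> (\<lambda>t. indicator {0..} t * f t) \<in> borel_measurable lebesgue"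
  by (simp add: borel_measurable_restrict_space_iff)

lemma halfline_integrable_iff:
  fixes f :: "real \<Rightarrow> real"
  shows "integrable halfline f \<longleftrightarrow> integrable lebesgue (\<lambda>t. indicator {0..} t * f t)"
  by (simp add: integrable_restrict_space)

lemma halfline_integral_eq:
  fixes f :: "real \<Rightarrow> real"
  shows "integral\<^sup>L halfline f = (\<integral>t. indicator {0..} t * f t \<partial>lebesgue)"
  by (simp add: integral_restrict_space)

lemma window_integral_translation:
  assumes "0 \<le> s" "0 \<le> a"
  shows "window_integral a b (translation s u) = window_integral (a + s) (b + s) u"
proof -
  obtain f where f: "f \<in> borel_measurable halfline" "u = abs_ae_fun f"
    by (rule ae_fun_cases)
  define h where "h x = indicator {a + s..b + s} x * (indicator {0..} x * f x)" for x
  have "h \<in> borel_measurable lebesgue"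
    using borel_measurable_times[OF borel_measurable_indicator f(1)[unfolded halfline_borel_measurable_iff],
        of "{a + s..b + s}"]
    by (simp add: h_def[abs_def])
  then have "(\<integral>t. h (s + t) \<partial>lebesgue) = integral\<^sup>L lebesgue h"
    using integral_lebesgue_affine(2)[of h 1 s] by simp
  moreover have "h (s + x) = indicator {0..} x * (indicator {a..b} x * f (x + s))" for x
    using assms by (auto simp: h_def indicator_def add.commute)
  moreover have "h = (\<lambda>x. indicator {0..} x * (indicator {a + s..b + s} x * f x))"
    by (auto simp: h_def indicator_def fun_eq_iff)
  ultimately show ?thesis
    using f assms translate_measurable[OF f(1) assms(1)]
    by (simp add: translation_abs window_integral_abs halfline_integral_eq)
qed

lemma sigma_finite_halfline: "sigma_finite_measure halfline"
proof -
  obtain A :: "real set set" where A: "countable A" "A \<subseteq> sets lborel" "\<Union>A = UNIV" "\<forall>a\<in>A. emeasure lborel a \<noteq> \<infinity>"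
    using lborel.sigma_finite_countable by auto
  have "sigma_finite_measure (lebesgue :: real measure)"
  proof
    show "\<exists>A::real set set. countable A \<and> A \<subseteq> sets lebesgue \<and> \<Union>A = space lebesgue \<and> (\<forall>a\<in>A. emeasure lebesgue a \<noteq> \<infinity>)"
      using A by (intro exI[of _ A]) auto
  qed
  then show ?thesis
    by (rule sigma_finite_measure_restrict_space) auto
qed


section \<open>Metric notions in a weighted Lebesgue space\<close>

locale weighted_Lp =
  fixes \<rho> :: "real \<Rightarrow> real" and p :: real
  assumes weight_measurable[measurable]: "\<rho> \<in> borel_measurable halfline"
    and weight_pos: "0 \<le> t \<Longrightarrow> 0 < \<rho> t"
    and one_le_p: "1 \<le> p"
begin

abbreviation "V \<equiv> Lp p \<rho>"
abbreviation "N \<equiv> Lp_norm p \<rho>"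

lemma weight_facts: "\<rho> \<in> borel_measurable halfline" "\<forall>t\<ge>0. \<rho> t > 0" "1 \<le> p"
  using weight_measurable weight_pos one_le_p by auto

lemmas N_nonneg = Lp_norm_nonneg[OF weight_facts]
  and V_add = Lp_add(1)[OF weight_facts]
  and V_scaleR = Lp_scaleR(1)[OF weight_facts]
  and N_scaleR = Lp_scaleR(2)[OF weight_facts]
  and V_subspace = subspace_Lp[OF weight_facts]
  and V_zero = zero_in_Lp[OF weight_facts]

lemmas V_diff = subspace_diff[OF V_subspace]

sublocale Metric_space V "\<lambda>u v. N (u - v)"
  by (rule Metric_space_Lp[OF weight_facts])

lemma dense_subset_iff:
  "dense_subset V N A \<longleftrightarrow> A \<subseteq> V \<and> (\<forall>u\<in>V. \<forall>e>0. \<exists>v\<in>A. N (u - v) < e)"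
proof -
  have "mtopology closure_of A = V \<longleftrightarrow> (\<forall>u\<in>V. \<forall>e>0. \<exists>v\<in>A. N (u - v) < e)" if "A \<subseteq> V"
    using that by (fastforce simp: metric_closure_of in_mball subset_iff)
  then show ?thesis
    unfolding dense_subset_def norm_topology_def by auto
qed

text \<open>
  A functional is continuous exactly if it is bounded. Boundedness is what gives estimates of
  \<open>\<phi> (K\<^sub>t)\<close> that are uniform in \<open>t\<close>.
\<close>

lemma dual_bounded:
  assumes "\<phi> \<in> dual_space V N"
  obtains K where "0 < K" and "\<And>u. u \<in> V \<Longrightarrow> \<bar>\<phi> u\<bar> \<le> K * N u"
proof -
  have lin: "\<phi> (c *\<^sub>R x) = c * \<phi> x" if "x \<in> V" for c x
    using assms that by (auto simp: dual_space_def)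
  have \<phi>0: "\<phi> 0 = 0"
    using lin[OF V_zero, of 0] by simp
  have "continuous_map mtopology euclideanreal \<phi>"
    using assms by (auto simp: dual_space_def norm_topology_def)
  then have "openin mtopology {u \<in> V. \<phi> u \<in> {-1<..<1}}"
    using openin_continuous_map_preimage[of mtopology euclideanreal \<phi> "{-1<..<1}"] by simp
  moreover have "0 \<in> {u \<in> V. \<phi> u \<in> {-1<..<1}}"
    using \<phi>0 V_zero by simp
  ultimately obtain d where d: "d > 0" "mball 0 d \<subseteq> {u \<in> V. \<phi> u \<in> {-1<..<1}}"
    unfolding openin_mtopology by blast
  have N_minus: "N (0 - u) = N u" if "u \<in> V" for u
    using N_scaleR[OF that, of "-1"] by simp
  have small: "\<bar>\<phi> u\<bar> < 1" if "u \<in> V" "N u < d" for u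
    using d(2) that N_minus V_zero by (force simp: in_mball subset_iff)
  have "\<bar>\<phi> u\<bar> \<le> (2 / d) * N u" if u: "u \<in> V" for u
  proof (rule ccontr)
    assume *: "\<not> \<bar>\<phi> u\<bar> \<le> (2 / d) * N u"
    then have pos: "\<bar>\<phi> u\<bar> > 0"
      using N_nonneg[of u] d(1) by (meson dual_order.trans not_le zero_le_divide_iff zero_le_mult_iff zero_le_numeral less_imp_le)
    define c where "c = 1 / \<bar>\<phi> u\<bar>"
    have "N (c *\<^sub>R u) < d"
    proof -
      have "N (c *\<^sub>R u) = N u / \<bar>\<phi> u\<bar>"
        using N_scaleR[OF u] by (simp add: c_def)
      moreover have "2 * N u < d * \<bar>\<phi> u\<bar>"
        using * d(1) by (simp add: field_simps)
      then have "N u < d * \<bar>\<phi> u\<bar>"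
        using N_nonneg[of u] by simp
      ultimately show ?thesis
        using pos by (simp add: pos_divide_less_eq)
    qed
    then have "\<bar>\<phi> (c *\<^sub>R u)\<bar> < 1"
      using small V_scaleR[OF u] by blast
    then show False
      using pos by (simp add: lin[OF u] c_def abs_mult)
  qed
  then show thesis
    using that[of "2 / d"] d(1) by simp
qed

lemma dual_spaceI:
  assumes add: "\<And>x y. x \<in> V \<Longrightarrow> y \<in> V \<Longrightarrow> \<phi> (x + y) = \<phi> x + \<phi> y"
    and scale: "\<And>c x. x \<in> V \<Longrightarrow> \<phi> (c *\<^sub>R x) = c * \<phi> x"
    and bd: "\<And>x. x \<in> V \<Longrightarrow> N x \<le> 1 \<Longrightarrow> \<bar>\<phi> x\<bar> \<le> K"
  shows "\<phi> \<in> dual_space V N"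
proof -
  have K: "0 \<le> K"
    using bd[OF V_zero] N_scaleR[OF V_zero, of 0] by simp
  have bound: "\<bar>\<phi> x\<bar> \<le> K * N x" if x: "x \<in> V" for x
  proof (rule field_le_epsilon)
    fix e :: real assume e: "0 < e"
    define r where "r = N x + e / (K + 1)"
    have "0 < e / (K + 1)" using e K by simp
    then have r: "0 < r" "N x \<le> r" using N_nonneg[of x] by (auto simp: r_def)
    then have "N ((1 / r) *\<^sub>R x) \<le> 1"
      using N_scaleR[OF x] by (simp add: field_simps)
    then have "\<bar>\<phi> ((1 / r) *\<^sub>R x)\<bar> \<le> K"
      by (intro bd V_scaleR x)
    then have "\<bar>\<phi> x\<bar> \<le> K * r"
      using r by (simp add: scale[OF x] field_simps)
    also have "\<dots> \<le> K * N x + e"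
    proof -
      have "K * (e / (K + 1)) \<le> e"
        using K e by (simp add: field_simps)
      then show ?thesis by (simp add: r_def distrib_left)
    qed
    finally show "\<bar>\<phi> x\<bar> \<le> K * N x + e" .
  qed
  have diff: "\<phi> (x - y) = \<phi> x - \<phi> y" if "x \<in> V" "y \<in> V" for x y
    using add[OF that(1) V_scaleR[OF that(2), of "-1"]] scale[OF that(2), of "-1"] by simp
  have "continuous_map mtopology euclideanreal \<phi>"
    unfolding continuous_map_eq_topcontinuous_at topcontinuous_at_def
  proof (intro ballI conjI allI impI)
    fix x assume x: "x \<in> topspace mtopology"
    show "x \<in> topspace mtopology" by fact
    show "\<phi> \<in> topspace mtopology \<rightarrow> topspace euclideanreal" by simp
    fix W assume "openin euclideanreal W \<and> \<phi> x \<in> W"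
    then obtain e where e: "e > 0" "ball (\<phi> x) e \<subseteq> W"
      by (auto simp: open_contains_ball)
    show "\<exists>U. openin mtopology U \<and> x \<in> U \<and> (\<forall>y\<in>U. \<phi> y \<in> W)"
    proof (intro exI[of _ "mball x (e / (K + 1))"] conjI ballI)
      show "openin mtopology (mball x (e / (K + 1)))" by (rule openin_mball)
      show "x \<in> mball x (e / (K + 1))"
        using x e(1) K by (simp only: centre_in_mball_iff) (simp add: divide_pos_pos)
      fix y assume "y \<in> mball x (e / (K + 1))"
      then have y: "x \<in> V" "y \<in> V" "N (x - y) < e / (K + 1)" by (auto simp: in_mball)
      have "\<bar>\<phi> x - \<phi> y\<bar> \<le> K * N (x - y)"
        using bound[OF V_diff[OF y(1,2)]] diff y by simp
      also have "\<dots> \<le> (K + 1) * N (x - y)"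
        using N_nonneg[of "x - y"] by (simp add: distrib_right)
      also have "\<dots> < e"
        using y(3) K by (simp add: field_simps)
      finally show "\<phi> y \<in> W"
        using e(2) by (auto simp: dist_real_def)
    qed
  qed
  then show ?thesis
    using add scale by (auto simp: dual_space_def norm_topology_def)
qed

lemma dual_tendsto:
  assumes "\<phi> \<in> dual_space V N" and "\<And>n. x n \<in> V" "y \<in> V" and "(\<lambda>n. N (x n - y)) \<longlonglongrightarrow> 0"
  shows "(\<lambda>n. \<phi> (x n)) \<longlonglongrightarrow> \<phi> y"
proof -
  obtain K where K: "0 < K" "\<And>u. u \<in> V \<Longrightarrow> \<bar>\<phi> u\<bar> \<le> K * N u"
    using dual_bounded[OF assms(1)] by blast
  have lin: "\<phi> (u + v) = \<phi> u + \<phi> v" "\<phi> (c *\<^sub>R u) = c * \<phi> u" if "u \<in> V" "v \<in> V" for u v c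
    using assms(1) that by (auto simp: dual_space_def)
  have "\<phi> (x n - y) = \<phi> (x n) - \<phi> y" for n
    using lin(1)[OF assms(2)[of n] V_scaleR[OF assms(3), of "-1"]] lin(2)[OF assms(3,3), of "-1"] by simp
  then have "\<bar>\<phi> (x n) - \<phi> y\<bar> \<le> K * N (x n - y)" for n
    using K(2)[OF V_diff[OF assms(2)[of n] assms(3)]] by simp
  moreover have "(\<lambda>n. K * N (x n - y)) \<longlonglongrightarrow> 0"
    using tendsto_mult_right_zero[OF assms(4)] by simp
  ultimately have "(\<lambda>n. \<phi> (x n) - \<phi> y) \<longlonglongrightarrow> 0"
    by (intro Lim_null_comparison[of "\<lambda>n. \<phi> (x n) - \<phi> y" "\<lambda>n. K * N (x n - y)"]) auto
  then show ?thesis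
    by (simp add: LIM_zero_iff)
qed

lemma dual_sum:
  assumes "\<phi> \<in> dual_space V N" "finite I" "\<And>i. i \<in> I \<Longrightarrow> x i \<in> V"
  shows "\<phi> (\<Sum>i\<in>I. c i *\<^sub>R x i) = (\<Sum>i\<in>I. c i * \<phi> (x i))"
proof -
  have lin: "\<phi> (u + v) = \<phi> u + \<phi> v" "\<phi> (c *\<^sub>R u) = c * \<phi> u" if "u \<in> V" "v \<in> V" for u v c
    using assms(1) that by (auto simp: dual_space_def)
  have "\<phi> 0 = 0" using lin(2)[OF V_zero V_zero, of 0] by simp
  with assms(2,3) show ?thesis
  proof (induction I rule: finite_induct)
    case (insert i I)
    moreover have "(\<Sum>i\<in>I. c i *\<^sub>R x i) \<in> V"
      using insert by (intro subspace_sum[OF V_subspace] V_scaleR) auto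
    ultimately show ?case
      using lin V_scaleR by simp
  qed simp
qed

text \<open>Dominated convergence, in the form in which it yields convergence in norm.\<close>

lemma Lp_dominated_convergence:
  assumes "\<And>n. f n \<in> borel_measurable halfline" "g \<in> borel_measurable halfline"
    and "AE t in halfline. (\<lambda>n. f n t) \<longlonglongrightarrow> g t"
    and "integrable halfline w"
    and "\<And>n. AE t in halfline. \<bar>f n t - g t\<bar> powr p * \<rho> t \<le> w t"
  shows "(\<lambda>n. N (abs_ae_fun (f n) - abs_ae_fun g)) \<longlonglongrightarrow> 0"
proof -
  have *: "(\<lambda>n. \<integral>t. \<bar>f n t - g t\<bar> powr p * \<rho> t \<partial>halfline) \<longlonglongrightarrow> (\<integral>t. 0 \<partial>halfline)"
  proof (rule integral_dominated_convergence[OF _ _ assms(4)])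
    show "AE t in halfline. (\<lambda>n. \<bar>f n t - g t\<bar> powr p * \<rho> t) \<longlonglongrightarrow> 0"
      using assms(3)
    proof eventually_elim
      case (elim t)
      then have "(\<lambda>n. \<bar>f n t - g t\<bar>) \<longlonglongrightarrow> 0"
        by (simp add: LIM_zero tendsto_rabs_zero)
      then have "(\<lambda>n. \<bar>f n t - g t\<bar> powr p) \<longlonglongrightarrow> 0 powr p"
        using one_le_p by (intro tendsto_powr2[OF _ tendsto_const]) auto
      then show ?case
        using tendsto_mult_left_zero by fastforce
    qed
    show "AE t in halfline. norm (\<bar>f n t - g t\<bar> powr p * \<rho> t) \<le> w t" for n
    proof -
      have "AE t in halfline. 0 < \<rho> t"
        using weight_pos by (intro AE_I2) auto
      then show ?thesis
        using assms(5)[of n] by eventually_elim (simp add: abs_mult)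
    qed
    show "(\<lambda>t. \<bar>f n t - g t\<bar> powr p * \<rho> t) \<in> borel_measurable halfline" for n
      using assms(1)[of n] assms(2) by measurable
  qed simp
  have "(\<lambda>n. (\<integral>t. \<bar>f n t - g t\<bar> powr p * \<rho> t \<partial>halfline) powr (1 / p)) \<longlonglongrightarrow> 0 powr (1 / p)"
    using one_le_p * by (intro tendsto_powr2[OF _ tendsto_const]) 
      (auto intro!: always_eventually integral_nonneg_AE AE_I2 simp: weight_pos less_imp_le)
  then show ?thesis
    using assms(1,2) by (simp add: abs_ae_fun_linear Lp_norm_abs)
qed

end

section \<open>Each side forces the weight to be integrable\<close>

text \<open>
  This inequality bounds \<open>\<integral> \<bar>v\<bar>\<close> by \<open>\<integral> \<bar>v\<bar>\<^sup>p\<close> over a bounded interval. The free parameter \<open>\<eta>\<close> makes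
  it strong enough to bound \<open>\<integral> \<bar>v\<bar>\<^sup>p\<close> away from zero, which would otherwise take Hoelder's inequality.
\<close>

lemma abs_le_powr_affine:
  fixes v \<eta> p :: real
  assumes "0 < \<eta>" "1 \<le> p"
  shows "\<bar>v\<bar> \<le> \<eta> + \<eta> powr (1 - p) * \<bar>v\<bar> powr p"
proof (cases "\<bar>v\<bar> \<le> \<eta>")
  case True
  then show ?thesis by (simp add: add_increasing2)
next
  case False
  then have "\<bar>v\<bar> = \<bar>v\<bar> powr (1 - p) * \<bar>v\<bar> powr p"
    using assms by (simp flip: powr_add)
  also have "\<dots> \<le> \<eta> powr (1 - p) * \<bar>v\<bar> powr p"
    using False assms by (intro mult_right_mono powr_mono2') auto
  finally show ?thesis using assms by simp
qed

lemma indicator_measurable_halfline: "(indicator {a..b} :: real \<Rightarrow> real) \<in> borel_measurable halfline"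
  by (intro measurable_restrict_space1 borel_measurable_indicator) simp

locale admissible_Lp = weighted_Lp +
  assumes admissible: "admissible_weight \<rho>"
begin

lemma weight_le_later:
  obtains C where "0 < C" and "\<And>x y. 0 \<le> y \<Longrightarrow> y \<le> x \<Longrightarrow> x \<le> y + L \<Longrightarrow> \<rho> y \<le> C * \<rho> x"
proof -
  from admissible obtain M \<omega> where M: "1 \<le> M"
    "\<And>\<tau> t. 0 \<le> \<tau> \<Longrightarrow> 0 < t \<Longrightarrow> \<rho> \<tau> \<le> M * exp (\<omega> * t) * \<rho> (\<tau> + t)"
    unfolding admissible_weight_def by blast
  have "\<rho> y \<le> M * exp (\<bar>\<omega>\<bar> * \<bar>L\<bar>) * \<rho> x" if xy: "0 \<le> y" "y \<le> x" "x \<le> y + L" for x y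
  proof (cases "x = y")
    case True
    have "1 * 1 \<le> M * exp (\<bar>\<omega>\<bar> * \<bar>L\<bar>)"
      using M(1) by (intro mult_mono) auto
    then have "1 * \<rho> y \<le> M * exp (\<bar>\<omega>\<bar> * \<bar>L\<bar>) * \<rho> y"
      using weight_pos[of y] xy by (intro mult_right_mono) auto
    then show ?thesis using True by simp
  next
    case False
    have "\<omega> * (x - y) \<le> \<bar>\<omega>\<bar> * \<bar>L\<bar>"
    proof -
      have "\<omega> * (x - y) \<le> \<bar>\<omega>\<bar> * (x - y)" using xy by (intro mult_right_mono) auto
      also have "\<dots> \<le> \<bar>\<omega>\<bar> * \<bar>L\<bar>" using xy by (intro mult_left_mono) auto
      finally show ?thesis .
    qed
    then have "M * exp (\<omega> * (x - y)) * \<rho> x \<le> M * exp (\<bar>\<omega>\<bar> * \<bar>L\<bar>) * \<rho> x"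
      using M(1) weight_pos[of x] xy by (intro mult_right_mono mult_left_mono) auto
    moreover have "\<rho> y \<le> M * exp (\<omega> * (x - y)) * \<rho> x"
      using M(2)[of y "x - y"] False xy by simp
    ultimately show ?thesis by simp
  qed
  then show thesis using that[of "M * exp (\<bar>\<omega>\<bar> * \<bar>L\<bar>)"] M(1) by simp
qed

text \<open>On bounded intervals the weight is bounded below, which makes window integrals continuous.\<close>

lemma window_powr_le:
  obtains C where "0 < C"
    "\<And>f a. f \<in> borel_measurable halfline \<Longrightarrow> integrable halfline (\<lambda>t. \<bar>f t\<bar> powr p * \<rho> t) \<Longrightarrow>
       integrable halfline (\<lambda>t. indicator {a..b} t * \<bar>f t\<bar> powr p)
       \<and> (\<integral>t. indicator {a..b} t * \<bar>f t\<bar> powr p \<partial>halfline) \<le> C * (\<integral>t. \<bar>f t\<bar> powr p * \<rho> t \<partial>halfline)"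
proof -
  obtain C where C: "0 < C" "\<And>x y. 0 \<le> y \<Longrightarrow> y \<le> x \<Longrightarrow> x \<le> y + b \<Longrightarrow> \<rho> y \<le> C * \<rho> x"
    using weight_le_later by blast
  have \<rho>0: "0 < \<rho> 0" using weight_pos[of 0] by simp
  have "integrable halfline (\<lambda>t. indicator {a..b} t * \<bar>f t\<bar> powr p)
       \<and> (\<integral>t. indicator {a..b} t * \<bar>f t\<bar> powr p \<partial>halfline) \<le> C / \<rho> 0 * (\<integral>t. \<bar>f t\<bar> powr p * \<rho> t \<partial>halfline)"
    if f[measurable]: "f \<in> borel_measurable halfline" and int: "integrable halfline (\<lambda>t. \<bar>f t\<bar> powr p * \<rho> t)"
    for f a
  proof -
    have le: "indicator {a..b} t * \<bar>f t\<bar> powr p \<le> C / \<rho> 0 * (\<bar>f t\<bar> powr p * \<rho> t)" if "0 \<le> t" for t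
    proof (cases "t \<in> {a..b}")
      case True
      then have "1 \<le> C / \<rho> 0 * \<rho> t"
        using C(2)[of 0 t] \<rho>0 that by (simp add: field_simps)
      then have "1 * \<bar>f t\<bar> powr p \<le> (C / \<rho> 0 * \<rho> t) * \<bar>f t\<bar> powr p"
        by (intro mult_right_mono) auto
      then show ?thesis
        using True by (simp add: mult_ac)
    next
      case False
      then show ?thesis
        using C(1) \<rho>0 weight_pos[OF that] by simp
    qed
    have *: "integrable halfline (\<lambda>t. indicator {a..b} t * \<bar>f t\<bar> powr p)"
    proof (rule Bochner_Integration.integrable_bound)
      show "integrable halfline (\<lambda>t. C / \<rho> 0 * (\<bar>f t\<bar> powr p * \<rho> t))"
        using int by (rule integrable_mult_right)
      show "AE t in halfline. norm (indicator {a..b} t * \<bar>f t\<bar> powr p) \<le> norm (C / \<rho> 0 * (\<bar>f t\<bar> powr p * \<rho> t))"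
      proof (rule AE_I2)
        fix t :: real assume "t \<in> space halfline"
        then have "indicator {a..b} t * \<bar>f t\<bar> powr p \<le> C / \<rho> 0 * (\<bar>f t\<bar> powr p * \<rho> t)"
          by (intro le) simp
        moreover have "0 \<le> indicator {a..b} t * \<bar>f t\<bar> powr p" by simp
        ultimately show "norm (indicator {a..b} t * \<bar>f t\<bar> powr p) \<le> norm (C / \<rho> 0 * (\<bar>f t\<bar> powr p * \<rho> t))"
          unfolding real_norm_def by linarith
      qed
      have "(indicator {a..b} :: real \<Rightarrow> real) \<in> borel_measurable halfline"
    by (rule indicator_measurable_halfline)
      then show "(\<lambda>t. indicator {a..b} t * \<bar>f t\<bar> powr p) \<in> borel_measurable halfline"
        by measurable
    qed
    moreover have "(\<integral>t. indicator {a..b} t * \<bar>f t\<bar> powr p \<partial>halfline)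
        \<le> (\<integral>t. C / \<rho> 0 * (\<bar>f t\<bar> powr p * \<rho> t) \<partial>halfline)"
      using * int le by (intro integral_mono integrable_mult_right) auto
    ultimately show ?thesis by simp
  qed
  then show thesis using that[of "C / \<rho> 0"] C(1) \<rho>0 by simp
qed

lemma window_powr_integrable:
  assumes "f \<in> borel_measurable halfline" "integrable halfline (\<lambda>t. \<bar>f t\<bar> powr p * \<rho> t)"
  shows "integrable halfline (\<lambda>t. indicator {a..b} t * \<bar>f t\<bar> powr p)"
  by (rule window_powr_le[of b]) (use assms in blast)

lemma indicator_halfline:
  assumes "0 \<le> a" "a \<le> b"
  shows "integrable halfline (indicator {a..b} :: real \<Rightarrow> real)" "(\<integral>t. indicator {a..b} t \<partial>halfline) = b - a"
proof -
  have eq: "indicator {0..} t * indicator {a..b} t = (indicator {a..b} t :: real)" for t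
    using assms by (auto simp: indicator_def)
  show "integrable halfline (indicator {a..b} :: real \<Rightarrow> real)"
    unfolding halfline_integrable_iff eq by (intro integrable_real_indicator) (auto simp: emeasure_lborel_Icc_eq)
  show "(\<integral>t. indicator {a..b} t \<partial>halfline) = b - a"
    unfolding halfline_integral_eq eq using assms by simp
qed

lemma window_integral_le:
  assumes f[measurable]: "f \<in> borel_measurable halfline" and int: "integrable halfline (\<lambda>t. \<bar>f t\<bar> powr p * \<rho> t)"
    and ab: "0 \<le> a" "a \<le> b"
  shows "integrable halfline (\<lambda>t. indicator {a..b} t * f t)"
    and "0 < \<eta> \<Longrightarrow> \<bar>\<integral>t. indicator {a..b} t * f t \<partial>halfline\<bar>
      \<le> \<eta> * (b - a) + \<eta> powr (1 - p) * (\<integral>t. indicator {a..b} t * \<bar>f t\<bar> powr p \<partial>halfline)"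
proof -
  have intp: "integrable halfline (\<lambda>t. indicator {a..b} t * \<bar>f t\<bar> powr p)"
    by (intro window_powr_integrable f int)
  define w where "w \<eta> t = \<eta> * indicator {a..b} t + \<eta> powr (1 - p) * (indicator {a..b} t * \<bar>f t\<bar> powr p)" for \<eta> t
  have w: "integrable halfline (w \<eta>)" for \<eta>
    unfolding w_def
    by (intro Bochner_Integration.integrable_add integrable_mult_right intp indicator_halfline(1)[OF ab])
  have le: "\<bar>indicator {a..b} t * f t\<bar> \<le> w \<eta> t" if "0 < \<eta>" for \<eta> t
    using abs_le_powr_affine[OF that one_le_p, of "f t"] by (simp add: w_def indicator_def)
  have "(indicator {a..b} :: real \<Rightarrow> real) \<in> borel_measurable halfline"
    by (rule indicator_measurable_halfline)
  then have "(\<lambda>t. indicator {a..b} t * f t) \<in> borel_measurable halfline"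
    by measurable
  then show *: "integrable halfline (\<lambda>t. indicator {a..b} t * f t)"
    using le[of 1] by (intro Bochner_Integration.integrable_bound[OF w[of 1]]) (auto intro!: AE_I2 order_trans[OF le[of 1] abs_ge_self])
  show "\<bar>\<integral>t. indicator {a..b} t * f t \<partial>halfline\<bar>
      \<le> \<eta> * (b - a) + \<eta> powr (1 - p) * (\<integral>t. indicator {a..b} t * \<bar>f t\<bar> powr p \<partial>halfline)"
    if \<eta>: "0 < \<eta>"
  proof -
    have "\<bar>\<integral>t. indicator {a..b} t * f t \<partial>halfline\<bar> \<le> (\<integral>t. \<bar>indicator {a..b} t * f t\<bar> \<partial>halfline)"
      by (rule integral_abs_bound)
    also have "\<dots> \<le> (\<integral>t. w \<eta> t \<partial>halfline)"
      using * w le[OF \<eta>] by (intro integral_mono) auto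
    also have "\<dots> = \<eta> * (b - a) + \<eta> powr (1 - p) * (\<integral>t. indicator {a..b} t * \<bar>f t\<bar> powr p \<partial>halfline)"
      unfolding w_def using intp indicator_halfline[OF ab] by simp
    finally show ?thesis .
  qed
qed

lemma window_integral_dual:
  assumes ab: "0 \<le> a" "a \<le> b"
  shows "window_integral a b \<in> dual_space V N"
proof -
  obtain C where C: "0 < C"
    "\<And>f a. f \<in> borel_measurable halfline \<Longrightarrow> integrable halfline (\<lambda>t. \<bar>f t\<bar> powr p * \<rho> t) \<Longrightarrow>
       integrable halfline (\<lambda>t. indicator {a..b} t * \<bar>f t\<bar> powr p)
       \<and> (\<integral>t. indicator {a..b} t * \<bar>f t\<bar> powr p \<partial>halfline) \<le> C * (\<integral>t. \<bar>f t\<bar> powr p * \<rho> t \<partial>halfline)"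
    using window_powr_le by blast
  show ?thesis
  proof (rule dual_spaceI)
    fix u v assume uv: "u \<in> V" "v \<in> V"
    obtain f where f: "f \<in> borel_measurable halfline" "u = abs_ae_fun f"
      by (rule ae_fun_cases)
    obtain g where g: "g \<in> borel_measurable halfline" "v = abs_ae_fun g"
      by (rule ae_fun_cases)
    have "integrable halfline (\<lambda>t. indicator {a..b} t * f t)" "integrable halfline (\<lambda>t. indicator {a..b} t * g t)"
      using uv f g ab by (auto simp: Lp_abs_iff intro: window_integral_le)
    then show "window_integral a b (u + v) = window_integral a b u + window_integral a b v"
      using f g by (simp add: abs_ae_fun_linear window_integral_abs distrib_left)
  next
    fix c u assume u: "u \<in> V"
    obtain f where f: "f \<in> borel_measurable halfline" "u = abs_ae_fun f"
      by (rule ae_fun_cases)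
    then show "window_integral a b (c *\<^sub>R u) = c * window_integral a b u"
      by (simp add: abs_ae_fun_scaleR window_integral_abs mult.left_commute[of _ c])
  next
    fix u assume u: "u \<in> V" "N u \<le> 1"
    obtain f where f: "f \<in> borel_measurable halfline" "u = abs_ae_fun f"
      by (rule ae_fun_cases)
    define I where "I = (\<integral>t. \<bar>f t\<bar> powr p * \<rho> t \<partial>halfline)"
    have I0: "0 \<le> I"
      unfolding I_def by (intro integral_nonneg_AE AE_I2) (auto simp: weight_pos less_imp_le)
    have "I powr (1 / p) \<le> 1"
      using u f by (simp add: Lp_norm_abs I_def)
    then have "(I powr (1 / p)) powr p \<le> 1 powr p"
      using one_le_p by (intro powr_mono2) auto
    then have "I \<le> 1"
      using I0 one_le_p by (simp add: powr_powr)
    then have "C * I \<le> C" using C(1) by simp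
    then show "\<bar>window_integral a b u\<bar> \<le> (b - a) + C"
      using window_integral_le(2)[OF f(1) _ ab, of 1] C(2)[OF f(1), of a] u f
      by (auto simp: window_integral_abs Lp_abs_iff I_def)
  qed
qed

text \<open>
  By admissibility \<open>\<rho> y\<close> is at most a constant times the integral of \<open>\<bar>u\<bar>\<^sup>p \<rho>\<close> over a window
  of fixed length that starts at \<open>y\<close>, as soon as \<open>\<bar>u\<bar>\<^sup>p\<close> has a fixed mass in each such window.
  When this is integrated over \<open>y\<close>, each point \<open>x\<close> lies in the windows that start in \<open>[x - L, x]\<close>,
  so the total is at most a constant times \<open>L \<integral> \<bar>u\<bar>\<^sup>p \<rho>\<close>.
\<close>

lemma integrable_weight_if_windows:
  assumes f[measurable]: "f \<in> borel_measurable halfline" and int: "integrable halfline (\<lambda>t. \<bar>f t\<bar> powr p * \<rho> t)"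
    and c: "0 < c" and L: "0 \<le> L"
    and windows: "\<And>y. 0 \<le> y \<Longrightarrow> c \<le> (\<integral>t. indicator {y..y + L} t * \<bar>f t\<bar> powr p \<partial>halfline)"
  shows "integrable halfline \<rho>"
proof -
  obtain C where C: "0 < C" "\<And>x y. 0 \<le> y \<Longrightarrow> y \<le> x \<Longrightarrow> x \<le> y + L \<Longrightarrow> \<rho> y \<le> C * \<rho> x"
    using weight_le_later by blast
  interpret H: sigma_finite_measure halfline
    by (rule sigma_finite_halfline)
  interpret HH: pair_sigma_finite halfline halfline ..
  define g where "g x = ennreal (\<bar>f x\<bar> powr p * \<rho> x)" for x
  define k where "k y x = (if y \<le> x \<and> x \<le> y + L then 1 else 0 :: ennreal)" for y x :: real
  have [measurable]: "(\<lambda>x. x) \<in> borel_measurable halfline"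
    by (rule measurable_restrict_space1) (simp add: measurable_completion)
  have g_meas[measurable]: "g \<in> borel_measurable halfline"
    unfolding g_def by measurable
  have k_meas[measurable]: "(\<lambda>z. k (fst z) (snd z)) \<in> borel_measurable (halfline \<Otimes>\<^sub>M halfline)"
    unfolding k_def by measurable
  have bound: "ennreal (c * \<rho> y) \<le> (\<integral>\<^sup>+ x. ennreal C * (k y x * g x) \<partial>halfline)" if y: "0 \<le> y" for y
  proof -
    have intw: "integrable halfline (\<lambda>t. indicator {y..y + L} t * \<bar>f t\<bar> powr p)"
      by (intro window_powr_integrable f int)
    have "ennreal (c * \<rho> y) \<le> ennreal (\<integral>t. \<rho> y * (indicator {y..y + L} t * \<bar>f t\<bar> powr p) \<partial>halfline)"
      using mult_right_mono[OF windows[OF y], of "\<rho> y"] weight_pos[OF y]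
      by (intro ennreal_leI) (simp add: mult.commute)
    also have "\<dots> = (\<integral>\<^sup>+ t. ennreal (\<rho> y * (indicator {y..y + L} t * \<bar>f t\<bar> powr p)) \<partial>halfline)"
      using intw weight_pos[OF y] by (intro nn_integral_eq_integral[symmetric] integrable_mult_right) auto
    also have "\<dots> \<le> (\<integral>\<^sup>+ x. ennreal C * (k y x * g x) \<partial>halfline)"
    proof (rule nn_integral_mono)
      fix x assume "x \<in> space halfline"
      show "ennreal (\<rho> y * (indicator {y..y + L} x * \<bar>f x\<bar> powr p)) \<le> ennreal C * (k y x * g x)"
      proof (cases "x \<in> {y..y + L}")
        case True
        then have "\<rho> y * \<bar>f x\<bar> powr p \<le> C * \<rho> x * \<bar>f x\<bar> powr p"
          using C(2)[OF y] by (intro mult_right_mono) auto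
        moreover have "0 < \<rho> x" using True y weight_pos by simp
        ultimately show ?thesis
          using True C(1) by (simp add: k_def g_def mult_ac flip: ennreal_mult')
      next
        case False
        then show ?thesis by simp
      qed
    qed
    finally show ?thesis .
  qed
  have "(\<integral>\<^sup>+ y. ennreal (c * \<rho> y) \<partial>halfline) \<le> (\<integral>\<^sup>+ y. (\<integral>\<^sup>+ x. ennreal C * (k y x * g x) \<partial>halfline) \<partial>halfline)"
    using bound by (intro nn_integral_mono) auto
  also have "\<dots> = (\<integral>\<^sup>+ x. (\<integral>\<^sup>+ y. ennreal C * (k y x * g x) \<partial>halfline) \<partial>halfline)"
    by (rule HH.Fubini'[symmetric]) measurable
  also have "\<dots> \<le> (\<integral>\<^sup>+ x. ennreal (C * L) * g x \<partial>halfline)"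
  proof (rule nn_integral_mono)
    fix x :: real assume "x \<in> space halfline"
    have "(\<integral>\<^sup>+ y. k y x \<partial>halfline) \<le> (\<integral>\<^sup>+ y. indicator {x - L..x} y \<partial>lebesgue)"
      unfolding nn_integral_restrict_space[of "{0..}::real set" lebesgue, simplified]
      by (intro nn_integral_mono) (auto simp: k_def indicator_def)
    also have "\<dots> = ennreal L"
      using L by simp
    finally have "(\<integral>\<^sup>+ y. k y x \<partial>halfline) * (ennreal C * g x) \<le> ennreal L * (ennreal C * g x)"
      by (rule mult_right_mono) simp
    moreover have "(\<integral>\<^sup>+ y. ennreal C * (k y x * g x) \<partial>halfline) = (\<integral>\<^sup>+ y. k y x * (ennreal C * g x) \<partial>halfline)"
      by (simp add: mult_ac)
    moreover have "\<dots> = (\<integral>\<^sup>+ y. k y x \<partial>halfline) * (ennreal C * g x)"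
      unfolding k_def by (intro nn_integral_multc) measurable
    ultimately show "(\<integral>\<^sup>+ y. ennreal C * (k y x * g x) \<partial>halfline) \<le> ennreal (C * L) * g x"
      using C(1) L by (simp add: ennreal_mult' mult_ac)
  qed
  also have "\<dots> = ennreal (C * L) * (\<integral>\<^sup>+ x. g x \<partial>halfline)"
    by (rule nn_integral_cmult) measurable
  also have "\<dots> < \<infinity>"
  proof -
    have "(\<integral>\<^sup>+ x. g x \<partial>halfline) = ennreal (\<integral>t. \<bar>f t\<bar> powr p * \<rho> t \<partial>halfline)"
      unfolding g_def using int
      by (intro nn_integral_eq_integral AE_I2) (auto simp: weight_pos less_imp_le)
    then show ?thesis by (simp add: ennreal_mult_less_top)
  qed
  finally have "integrable halfline (\<lambda>y. c * \<rho> y)"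
    using c weight_pos by (intro integrableI_nonneg AE_I2) (auto simp: less_imp_le)
  then have "integrable halfline (\<lambda>y. (1 / c) * (c * \<rho> y))"
    by (rule integrable_mult_right)
  then show ?thesis using c by simp
qed

text \<open>
  A nonzero window integral that repeats with period \<open>s\<close> forces a fixed mass of \<open>\<bar>u\<bar>\<^sup>p\<close> in each of the
  windows of length \<open>s + 1\<close>, since each of these contains an interval \<open>[n s, n s + 1]\<close>.
\<close>

lemma integrable_weight_if_periodic_windows:
  assumes u: "u \<in> V" and s: "0 < s" and c: "c \<noteq> 0"
    and per: "\<And>n. window_integral (real n * s) (1 + real n * s) u = c"
  shows "integrable halfline \<rho>"
proof -
  obtain f where f: "f \<in> borel_measurable halfline" "u = abs_ae_fun f"
    by (rule ae_fun_cases)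
  have int: "integrable halfline (\<lambda>t. \<bar>f t\<bar> powr p * \<rho> t)"
    using u f by (simp add: Lp_abs_iff)
  \<comment> \<open>With this \<open>\<eta>\<close>, the bound of \<open>\<bar>c\<bar>\<close> by \<open>\<eta>\<close> plus a \<open>p\<close>-th power mass leaves at least \<open>\<eta>\<close> for the mass.\<close>
  define \<eta> where "\<eta> = \<bar>c\<bar> / 2"
  have \<eta>: "0 < \<eta>" using c by (simp add: \<eta>_def)
  show ?thesis
  proof (rule integrable_weight_if_windows[OF f(1) int])
    show "0 < \<eta> / \<eta> powr (1 - p)" using \<eta> by simp
    show "0 \<le> s + 1" using s by simp
    fix y :: real assume y: "0 \<le> y"
    define n where "n = nat \<lceil>y / s\<rceil>"
    have "real n = of_int \<lceil>y / s\<rceil>"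
      using y s by (simp add: n_def)
    then have "y / s \<le> real n" "real n \<le> y / s + 1"
      by linarith+
    then have n: "y \<le> real n * s" "real n * s \<le> y + s"
      using s by (simp_all add: field_simps)
    have intw: "integrable halfline (\<lambda>t. indicator {a..b} t * \<bar>f t\<bar> powr p)" for a b
      by (intro window_powr_integrable f int)
    have "\<bar>c\<bar> \<le> \<eta> + \<eta> powr (1 - p) * (\<integral>t. indicator {real n * s..1 + real n * s} t * \<bar>f t\<bar> powr p \<partial>halfline)"
      using window_integral_le(2)[OF f(1) int _ _ \<eta>, of "real n * s" "1 + real n * s"] per[of n] f s
      by (simp add: window_integral_abs)
    also have "(\<integral>t. indicator {real n * s..1 + real n * s} t * \<bar>f t\<bar> powr p \<partial>halfline)
        \<le> (\<integral>t. indicator {y..y + (s + 1)} t * \<bar>f t\<bar> powr p \<partial>halfline)"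
      using n by (intro integral_mono intw) (auto simp: indicator_def)
    finally show "\<eta> / \<eta> powr (1 - p) \<le> (\<integral>t. indicator {y..y + (s + 1)} t * \<bar>f t\<bar> powr p \<partial>halfline)"
      using \<eta> by (simp add: \<eta>_def divide_le_eq mult.commute)
  qed
qed

text \<open>The functional is nonzero on the indicator of \<open>[0, 1]\<close>, hence on all points close to it.\<close>

lemma dense_window_nonzero:
  assumes "dense_subset V N A"
  obtains v where "v \<in> A" "window_integral 0 1 v \<noteq> 0"
proof -
  define e where "e = abs_ae_fun (indicator {0..1})"
  have [measurable]: "indicator {0..1} \<in> borel_measurable halfline"
    by (intro borel_measurable_indicator) (auto simp: sets_restrict_space_iff)
  obtain C where C: "0 < C" "\<And>x y. 0 \<le> y \<Longrightarrow> y \<le> x \<Longrightarrow> x \<le> y + 1 \<Longrightarrow> \<rho> y \<le> C * \<rho> x"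
    using weight_le_later by blast
  have "integrable halfline (\<lambda>t. \<bar>indicator {0..1} t\<bar> powr p * \<rho> t)"
  proof (rule Bochner_Integration.integrable_bound)
    show "integrable halfline (\<lambda>t. C * \<rho> 1 * indicator {0..1} t)"
      using indicator_halfline[of 0 1] by simp
    show "AE t in halfline. norm (\<bar>indicator {0..1} t\<bar> powr p * \<rho> t) \<le> norm (C * \<rho> 1 * indicator {0..1} t)"
    proof (rule AE_I2)
      fix t :: real assume "t \<in> space halfline"
      then show "norm (\<bar>indicator {0..1} t\<bar> powr p * \<rho> t) \<le> norm (C * \<rho> 1 * indicator {0..1} t)"
        using C(2)[of t 1] weight_pos[of t] by (auto simp: indicator_def)
    qed
  qed measurable
  then have e: "e \<in> V"
    unfolding e_def by (simp add: Lp_abs_iff)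
  have W: "window_integral 0 1 \<in> dual_space V N"
    by (rule window_integral_dual) auto
  have "window_integral 0 1 e = (\<integral>t. indicator {0..1} t \<partial>halfline)"
    by (simp add: e_def window_integral_abs flip: indicator_inter_arith)
  then have We: "window_integral 0 1 e = 1"
    using indicator_halfline[of 0 1] by simp
  have "\<exists>v\<in>A. N (e - v) < r" if "0 < r" for r
    using assms e that unfolding dense_subset_iff by blast
  then have "\<forall>n. \<exists>v. v \<in> A \<and> N (e - v) < 1 / Suc n"
    by (metis of_nat_0_less_iff zero_less_Suc zero_less_divide_1_iff)
  then obtain v where v: "\<And>n. v n \<in> A" "\<And>n. N (e - v n) < 1 / Suc n"
    by metis
  have "(\<lambda>n. N (v n - e)) \<longlonglongrightarrow> 0"
  proof (rule tendsto_sandwich[OF _ _ tendsto_const LIMSEQ_inverse_real_of_nat])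
    show "\<forall>\<^sub>F n in sequentially. N (v n - e) \<le> inverse (real (Suc n))"
      by (intro always_eventually allI less_imp_le) (use v(2) in \<open>simp add: commute[of _ e] inverse_eq_divide\<close>)
  qed (use N_nonneg in auto)
  moreover have vV: "v n \<in> V" for n
    using assms v(1) unfolding dense_subset_iff by blast
  ultimately have "(\<lambda>n. window_integral 0 1 (v n)) \<longlonglongrightarrow> 1"
    using dual_tendsto[OF W vV e] We by simp
  then have "\<forall>\<^sub>F n in sequentially. window_integral 0 1 (v n) > 0"
    by (rule order_tendstoD(1)) simp
  then obtain n where "window_integral 0 1 (v n) > 0"
    by (auto simp: eventually_sequentially)
  then show thesis using that[OF v(1)[of n]] by simp
qed

lemma chaotic_imp_integrable_weight:
  assumes "chaotic V N translation"
  shows "integrable halfline \<rho>"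
proof -
  obtain v where v: "v \<in> periodic_points V translation" "window_integral 0 1 v \<noteq> 0"
    using assms dense_window_nonzero unfolding chaotic_def by blast
  then obtain s where s: "0 < s" "translation s v = v" and vV: "v \<in> V"
    unfolding periodic_points_def by blast
  have "window_integral (real n * s) (1 + real n * s) v = window_integral 0 1 v" for n
  proof (induction n)
    case (Suc n)
    then show ?case
      using window_integral_translation[of s "real n * s" "1 + real n * s" v] s by (simp add: algebra_simps)
  qed simp
  then show ?thesis
    using integrable_weight_if_periodic_windows[OF vV s(1) v(2)] by blast
qed

end

lemma integral_lebesgue_on:
  fixes F :: "real \<Rightarrow> real"
  assumes "E \<in> sets lebesgue"
  shows "integral\<^sup>L (lebesgue_on E) F = (\<integral>t. indicator E t * F t \<partial>lebesgue)"
  using assms by (simp add: integral_restrict_space)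

lemma Pettis_integrableD:
  assumes "Pettis_integrable V N f" "E \<in> sets lebesgue" "E \<subseteq> {0..}"
  shows "\<exists>x\<in>V. \<forall>\<phi>\<in>dual_space V N. \<phi> x = (\<integral>t. \<phi> (f t) \<partial>lebesgue_on E)"
  using assms unfolding Pettis_integrable_def by blast

context admissible_Lp
begin

lemma window_integral_tendsto_0:
  assumes u: "u \<in> V" and r: "\<And>n. 0 \<le> r n" "r \<longlonglongrightarrow> 0"
  shows "(\<lambda>n. window_integral (r n) (1 + r n) u) \<longlonglongrightarrow> window_integral 0 1 u"
proof -
  obtain f where f[measurable]: "f \<in> borel_measurable halfline" and uf: "u = abs_ae_fun f"
    by (rule ae_fun_cases)
  have int: "integrable halfline (\<lambda>t. \<bar>f t\<bar> powr p * \<rho> t)"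
    using u uf f by (simp add: Lp_abs_iff)
  obtain R where R: "\<And>n. r n \<le> R"
    using convergent_imp_Bseq[OF convergentI[OF r(2)]] by (auto simp: Bseq_def abs_le_iff)
  have "R \<ge> 0" using R[of 0] r(1)[of 0] by linarith
  have [measurable]: "(indicator {a..b} :: real \<Rightarrow> real) \<in> borel_measurable halfline" for a b :: real
    by (rule indicator_measurable_halfline)
  have "(\<lambda>n. \<integral>t. indicator {r n..1 + r n} t * f t \<partial>halfline) \<longlonglongrightarrow> (\<integral>t. indicator {0..1} t * f t \<partial>halfline)"
  proof (rule integral_dominated_convergence[where w = "\<lambda>t. \<bar>indicator {0..1 + R} t * f t\<bar>"])
    show "integrable halfline (\<lambda>t. \<bar>indicator {0..1 + R} t * f t\<bar>)"
      using window_integral_le(1)[OF f int, of 0 "1 + R"] \<open>R \<ge> 0\<close> by simp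
    show "AE t in halfline. norm (indicator {r n..1 + r n} t * f t) \<le> \<bar>indicator {0..1 + R} t * f t\<bar>" for n
      using r(1)[of n] R[of n] by (intro AE_I2) (auto simp: indicator_def)
    have "AE t in halfline. t \<noteq> 0 \<and> t \<noteq> 1"
    proof (rule AE_I')
      show "{0, 1} \<in> null_sets halfline"
        by (subst null_sets_restrict_space) (auto simp: null_sets_completionI finite_imp_null_set_lborel)
      show "{t \<in> space halfline. \<not> (t \<noteq> 0 \<and> t \<noteq> 1)} \<subseteq> {0, 1}" by auto
    qed
    moreover have "AE t in halfline. 0 \<le> t" by (intro AE_I2) auto
    ultimately show "AE t in halfline. (\<lambda>n. indicator {r n..1 + r n} t * f t) \<longlonglongrightarrow> indicator {0..1} t * f t"
    proof eventually_elim
      case (elim t)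
      have "\<forall>\<^sub>F n in sequentially. indicator {r n..1 + r n} t * f t = indicator {0..1} t * f t"
      proof (cases "t < 1")
        case True
        have "\<forall>\<^sub>F n in sequentially. r n < t"
          using r(2) elim by (intro order_tendstoD(2)[of r 0]) auto
        then show ?thesis
        proof eventually_elim
          case (elim n)
          then show ?case using True r(1)[of n] \<open>0 \<le> t\<close> by (auto simp: indicator_def)
        qed
      next
        case False
        have "\<forall>\<^sub>F n in sequentially. r n < t - 1"
          using r(2) elim False by (intro order_tendstoD(2)[of r 0]) auto
        then show ?thesis
          by eventually_elim (use False elim in \<open>auto simp: indicator_def\<close>)
      qed
      then show ?case by (rule tendsto_eventually)
    qed
  qed measurable
  then show ?thesis
    using f uf by (simp add: window_integral_abs)
qed

lemma window_integral_near_0: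
  assumes u: "u \<in> V" and c: "window_integral 0 1 u \<noteq> 0"
  obtains d where "0 < d" "\<And>r. 0 \<le> r \<Longrightarrow> r < d \<Longrightarrow>
    \<bar>window_integral r (1 + r) u - window_integral 0 1 u\<bar> < \<bar>window_integral 0 1 u\<bar> / 2"
proof -
  let ?c = "window_integral 0 1 u"
  have "\<exists>d>0. \<forall>r. 0 \<le> r \<longrightarrow> r < d \<longrightarrow> \<bar>window_integral r (1 + r) u - ?c\<bar> < \<bar>?c\<bar> / 2"
  proof (rule ccontr)
    assume *: "\<not> ?thesis"
    have "\<exists>r. 0 \<le> r \<and> r < 1 / Suc n \<and> \<not> \<bar>window_integral r (1 + r) u - ?c\<bar> < \<bar>?c\<bar> / 2" for n
      using * by (metis of_nat_0_less_iff zero_less_Suc zero_less_divide_1_iff)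
    then obtain r where r: "\<And>n. 0 \<le> r n" "\<And>n. r n < 1 / Suc n"
      "\<And>n. \<not> \<bar>window_integral (r n) (1 + r n) u - ?c\<bar> < \<bar>?c\<bar> / 2"
      by metis
    have "r \<longlonglongrightarrow> 0"
    proof (rule tendsto_sandwich[OF _ _ tendsto_const LIMSEQ_inverse_real_of_nat])
      show "\<forall>\<^sub>F n in sequentially. r n \<le> inverse (real (Suc n))"
        by (intro always_eventually allI less_imp_le) (use r(2) in \<open>simp add: inverse_eq_divide\<close>)
    qed (use r(1) in auto)
    then have "(\<lambda>n. window_integral (r n) (1 + r n) u) \<longlonglongrightarrow> ?c"
      by (rule window_integral_tendsto_0[OF u r(1)])
    then have "(\<lambda>n. \<bar>window_integral (r n) (1 + r n) u - ?c\<bar>) \<longlonglongrightarrow> 0"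
      by (simp add: LIM_zero tendsto_rabs_zero)
    then have "\<forall>\<^sub>F n in sequentially. \<bar>window_integral (r n) (1 + r n) u - ?c\<bar> < \<bar>?c\<bar> / 2"
      using c by (intro order_tendstoD(2)) auto
    then show False using r(3) by (auto simp: eventually_sequentially)
  qed
  then show thesis using that by blast
qed

text \<open>
  The orbit of \<open>x\<close>, continued by \<open>S\<^sub>r x\<close> to the times \<open>- r < 0\<close>, is integrated over a set of times
  that is invariant under shifts by \<open>s\<close>. Translation by \<open>s\<close> shifts the continued orbit, so the window
  integrals of the result repeat along multiples of \<open>s\<close>. As \<open>s\<close> grows, the set of times tends to
  \<open>[0, d[\<close>, and the window integral over \<open>[0, 1]\<close> tends to \<open>\<integral>\<^sub>0\<^sup>d (\<integral>\<^sub>r\<^sup>1\<^sup>+\<^sup>r x) dr\<close>, which is not zero for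
  small \<open>d\<close> if \<open>x\<close> has a nonzero integral over \<open>[0, 1]\<close>.
\<close>

lemma frequent_hypercyclicity_criterion_imp_integrable_weight:
  assumes "frequent_hypercyclicity_criterion V N translation"
  shows "integrable halfline \<rho>"
proof -
  obtain X0 S where X0: "dense_subset V N X0"
    and S_in: "\<forall>t>0. \<forall>x\<in>X0. S t x \<in> V"
    and TS: "\<forall>x\<in>X0. \<forall>t>0. translation t (S t x) = x"
    and TS': "\<forall>x\<in>X0. \<forall>t>0. \<forall>r>t. translation t (S r x) = S (r - t) x"
    and PT: "\<forall>x\<in>X0. Pettis_integrable V N (\<lambda>t. translation t x)"
    and PS: "\<forall>x\<in>X0. Pettis_integrable V N (\<lambda>t. S t x)"
    using assms unfolding frequent_hypercyclicity_criterion_def by blast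
  obtain x where x: "x \<in> X0" "window_integral 0 1 x \<noteq> 0"
    using dense_window_nonzero[OF X0] by blast
  have xV: "x \<in> V" using x X0 unfolding dense_subset_iff by blast
  define c where "c = window_integral 0 1 x"
  define W where "W r = window_integral r (1 + r)" for r
  have W_dual: "W r \<in> dual_space V N" if "0 \<le> r" for r
    unfolding W_def using that by (intro window_integral_dual) auto
  have W_T: "W r (translation t u) = W (r + t) u" if "0 \<le> r" "0 \<le> t" for r t u
    unfolding W_def using window_integral_translation[OF that(2,1), of "1 + r" u] by (simp add: add.assoc)
  obtain d where d: "0 < d" "\<And>r. 0 \<le> r \<Longrightarrow> r < d \<Longrightarrow> \<bar>W r x - c\<bar> < \<bar>c\<bar> / 2"
    using window_integral_near_0[OF xV x(2)] unfolding W_def c_def by blast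
  define H where "H r = (if 0 \<le> r then W 0 (translation r x) else W 0 (S (- r) x))" for r
  have H_pos: "H r = W r x" if "0 \<le> r" for r
    using that W_T[of 0 r x] by (simp add: H_def)
  define HT where "HT m r = indicator {0..} r * W m (translation r x)" for m r :: real
  define HS where "HS m r = indicator {0<..} r * W m (S r x)" for m r :: real
  have HT_int: "integrable lebesgue (HT m)" if "0 \<le> m" for m
    using PT x(1) W_dual[OF that] unfolding HT_def Pettis_integrable_def
    by (auto simp flip: halfline_integrable_iff)
  have HS_int: "integrable lebesgue (HS m)" if "0 \<le> m" for m
  proof -
    have "integrable lebesgue (\<lambda>r. indicator {0..} r * W m (S r x))"
      using PS x(1) W_dual[OF that] unfolding Pettis_integrable_def
      by (auto simp flip: halfline_integrable_iff)
    then have "integrable lebesgue (\<lambda>r. indicator {0<..} r *\<^sub>R (indicator {0..} r * W m (S r x)))"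
      by (intro integrable_mult_indicator) auto
    moreover have "(\<lambda>r. indicator {0<..} r *\<^sub>R (indicator {0..} r * W m (S r x))) = HS m"
      by (auto simp: HS_def indicator_def fun_eq_iff)
    ultimately show ?thesis by simp
  qed
  \<comment> \<open>The four cases are the possible positions of the times \<open>r\<close> and \<open>m + r\<close> relative to \<open>0\<close>,
      where the orbit changes from \<open>S\<close> to the semigroup.\<close>
  have H_shift: "H (m + r) = HT m r + HS m (- r)" if m: "0 \<le> m" for m r
  proof -
    consider "0 \<le> r" | "r < 0" "m + r = 0" | "r < 0" "m + r < 0" | "r < 0" "m + r > 0"
      by linarith
    then show ?thesis
    proof cases
      case 1
      then show ?thesis using W_T[OF m 1, of x] m by (simp add: HT_def HS_def H_pos)
    next
      case 2
      then have "- r = m" by simp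
      then have "W m (S (- r) x) = W 0 (translation m (S m x))"
        using W_T[of 0 m] m by simp
      also have "\<dots> = W 0 x" using TS x(1) 2 by simp
      finally show ?thesis using 2 by (simp add: HT_def HS_def H_pos)
    next
      case 3
      have "W m (S (- r) x) = W 0 (translation m (S (- r) x))"
        using W_T[of 0 m] m by simp
      also have "\<dots> = W 0 (S (- (m + r)) x)"
      proof (cases "m = 0")
        case True
        then show ?thesis using W_T[of 0 0 "S (- r) x"] by simp
      next
        case False
        then have "translation m (S (- r) x) = S (- r - m) x" using TS' x(1) 3 m by simp
        then show ?thesis by (simp only: minus_add_distrib diff_conv_add_uminus add.commute)
      qed
      finally show ?thesis using 3 by (simp add: HT_def HS_def H_def)
    next
      case 4
      have "W m (S (- r) x) = W (m + r) (translation (- r) (S (- r) x))"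
        using W_T[of "m + r" "- r"] 4 by simp
      also have "\<dots> = W (m + r) x" using TS x(1) 4 by simp
      finally show ?thesis using 4 by (simp add: HT_def HS_def H_pos)
    qed
  qed
  have H_eq: "H = (\<lambda>r. HT 0 r + HS 0 (- r))"
    using H_shift[of 0] by (simp add: fun_eq_iff)
  have reflect: "integrable lebesgue (\<lambda>r. h (- r))" "(\<integral>r. h (- r) \<partial>lebesgue) = integral\<^sup>L lebesgue h"
    if "integrable lebesgue h" for h :: "real \<Rightarrow> real"
    using integral_lebesgue_affine[of h "-1" 0] that by auto
  have H_int: "integrable lebesgue H"
    unfolding H_eq using HT_int[of 0] reflect(1)[OF HS_int[of 0]] by simp
  \<comment> \<open>The union of the intervals \<open>[n s, n s + d[\<close> over all integers \<open>n\<close>, if \<open>s > 0\<close>.\<close>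
  define E where "E s = {r. r - s * of_int \<lfloor>r / s\<rfloor> < d}" for s :: real
  have E_meas: "E s \<in> sets lebesgue" for s
  proof -
    have "E s \<in> sets borel" unfolding E_def by measurable
    then show ?thesis by simp
  qed
  have E_shift: "s * real n + r \<in> E s \<longleftrightarrow> r \<in> E s" if "0 < s" for s n r
  proof -
    have "(s * real n + r) / s = r / s + of_int (int n)"
      using that by (simp add: add_divide_distrib)
    then have "\<lfloor>(s * real n + r) / s\<rfloor> = \<lfloor>r / s\<rfloor> + int n"
      by (simp only: floor_add_int[symmetric])
    then show ?thesis by (simp add: E_def algebra_simps)
  qed
  have average: "\<exists>y\<in>V. \<forall>n. W (real n * s) y = (\<integral>r. indicator (E s) r * H r \<partial>lebesgue)" if s: "0 < s" for s
  proof -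
    \<comment> \<open>The criterion provides vector integrals over nonnegative and over negative times separately.\<close>
    let ?ET = "E s \<inter> {0..}" and ?ES = "uminus -` E s \<inter> {0<..}"
    have ET: "?ET \<in> sets lebesgue" using E_meas by auto
    have affine: "(\<lambda>r. 0 + a * r) \<in> lebesgue \<rightarrow>\<^sub>M (lebesgue :: real measure)" if "a \<noteq> 0" for a :: real
      using lebesgue_affine_measurable[of "\<lambda>_::real. a" 0] that by simp
    have ES: "uminus -` E s \<in> sets lebesgue"
      using measurable_sets[OF affine[of "-1"] E_meas[of s]] by simp
    then have ES': "?ES \<in> sets lebesgue" by auto
    have ES_sub: "?ES \<subseteq> {0..}" by (auto intro: less_imp_le)
    obtain yT where yT: "yT \<in> V" "\<forall>\<phi>\<in>dual_space V N. \<phi> yT = (\<integral>t. \<phi> (translation t x) \<partial>lebesgue_on ?ET)"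
      using Pettis_integrableD[OF PT[rule_format, OF x(1)] ET] by auto
    obtain yS where yS: "yS \<in> V" "\<forall>\<phi>\<in>dual_space V N. \<phi> yS = (\<integral>t. \<phi> (S t x) \<partial>lebesgue_on ?ES)"
      using Pettis_integrableD[OF PS[rule_format, OF x(1)] ES' ES_sub] by blast
    have "W (real n * s) (yT + yS) = (\<integral>r. indicator (E s) r * H r \<partial>lebesgue)" for n
    proof -
      define m where "m = real n * s"
      have m: "0 \<le> m" using s by (simp add: m_def)
      have iT: "integrable lebesgue (\<lambda>r. indicator (E s) r * HT m r)"
        using integrable_mult_indicator[OF E_meas HT_int[OF m], of s] by simp
      have iS: "integrable lebesgue (\<lambda>r. indicator (E s) (- r) * HS m r)"
        using integrable_mult_indicator[OF ES HS_int[OF m]] by (simp add: indicator_vimage)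
      have "W m (yT + yS) = W m yT + W m yS"
        using W_dual[OF m] yT yS unfolding dual_space_def by blast
      also have "W m yT = (\<integral>r. indicator (E s) r * HT m r \<partial>lebesgue)"
        using yT(2)[rule_format, OF W_dual[OF m]]
        by (simp add: integral_lebesgue_on[OF ET] HT_def indicator_inter_arith mult.assoc)
      also have "W m yS = (\<integral>r. indicator (E s) (- r) * HS m r \<partial>lebesgue)"
        using yS(2)[rule_format, OF W_dual[OF m]]
        by (simp add: integral_lebesgue_on[OF ES'] HS_def indicator_inter_arith indicator_vimage mult.assoc)
      also have "\<dots> = (\<integral>r. indicator (E s) r * HS m (- r) \<partial>lebesgue)"
        using reflect(2)[OF iS] by simp
      also have "(\<integral>r. indicator (E s) r * HT m r \<partial>lebesgue) + (\<integral>r. indicator (E s) r * HS m (- r) \<partial>lebesgue)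
          = (\<integral>r. indicator (E s) r * HT m r + indicator (E s) r * HS m (- r) \<partial>lebesgue)"
        using iT reflect(1)[OF iS] by (simp add: Bochner_Integration.integral_add)
      also have "\<dots> = (\<integral>r. indicator (E s) (m + 1 * r) * H (m + 1 * r) \<partial>lebesgue)"
      proof -
        have "indicator (E s) (m + r) = (indicator (E s) r :: real)" for r
          using E_shift[OF s, of n r] by (simp add: m_def indicator_def mult.commute)
        then show ?thesis by (simp add: H_shift[OF m] distrib_left)
      qed
      also have "\<dots> = (\<integral>r. indicator (E s) r * H r \<partial>lebesgue)"
        using integral_lebesgue_affine(2)[of "\<lambda>r. indicator (E s) r * H r" 1 m]
          integrable_mult_indicator[OF E_meas H_int, of s] by simp
      finally show ?thesis by (simp add: m_def)
    qed
    then show ?thesis using yT(1) yS(1) V_add by blast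
  qed
  have lim: "(\<lambda>k. \<integral>r. indicator (E (real (Suc k))) r * H r \<partial>lebesgue) \<longlonglongrightarrow> (\<integral>r. indicator {0..<d} r * H r \<partial>lebesgue)"
  proof (rule integral_dominated_convergence[where w = "\<lambda>r. \<bar>H r\<bar>"])
    show "(\<lambda>r. indicator {0..<d} r * H r) \<in> borel_measurable lebesgue"
      using H_int by (intro borel_measurable_times borel_measurable_indicator) auto
    show "(\<lambda>r. indicator (E (real (Suc k))) r * H r) \<in> borel_measurable lebesgue" for k
      using H_int E_meas by (intro borel_measurable_times borel_measurable_indicator) auto
    show "integrable lebesgue (\<lambda>r. \<bar>H r\<bar>)" using H_int by simp
    show "AE r in lebesgue. norm (indicator (E (real (Suc k))) r * H r) \<le> \<bar>H r\<bar>" for k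
      by (intro AE_I2) (auto simp: indicator_def)
    show "AE r in lebesgue. (\<lambda>k. indicator (E (real (Suc k))) r * H r) \<longlonglongrightarrow> indicator {0..<d} r * H r"
    proof (intro AE_I2 tendsto_eventually)
      fix r :: real
      have "\<forall>\<^sub>F k in sequentially. \<bar>r\<bar> + d < real (Suc k)"
        using eventually_gt_at_top[of "nat \<lceil>\<bar>r\<bar> + d\<rceil>"]
      proof eventually_elim
        case (elim k)
        then show ?case using real_nat_ceiling_ge[of "\<bar>r\<bar> + d"] by linarith
      qed
      then show "\<forall>\<^sub>F k in sequentially. indicator (E (real (Suc k))) r * H r = indicator {0..<d} r * H r"
      proof eventually_elim
        case (elim k)
        show ?case
        proof (cases "0 \<le> r")
          case True
          then have "\<lfloor>r / real (Suc k)\<rfloor> = 0"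
            using elim d(1) by (intro floor_unique) auto
          then show ?thesis using True by (simp add: E_def indicator_def)
        next
          case False
          then have "\<lfloor>r / real (Suc k)\<rfloor> = -1"
            using elim d(1) by (intro floor_unique) (auto simp: field_simps)
          then show ?thesis using False elim by (simp add: E_def indicator_def)
        qed
      qed
    qed
  qed
  have "(\<integral>r. indicator {0..<d} r * H r \<partial>lebesgue) \<noteq> 0"
  proof -
    have i1: "integrable lebesgue (\<lambda>r. indicator {0..<d} r * H r)"
      using integrable_mult_indicator[OF _ H_int, of "{0..<d}"] by simp
    have i2: "integrable lebesgue (\<lambda>r. indicator {0..<d} r * a)" for a :: real
      using d(1) by (intro integrable_mult_left integrable_real_indicator) auto
    have e2: "(\<integral>r. indicator {0..<d} r * a \<partial>lebesgue) = d * a" for a :: real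
      using d(1) by simp
    have "\<bar>(\<integral>r. indicator {0..<d} r * H r \<partial>lebesgue) - d * c\<bar>
        = \<bar>\<integral>r. indicator {0..<d} r * H r - indicator {0..<d} r * c \<partial>lebesgue\<bar>"
      by (simp only: Bochner_Integration.integral_diff[OF i1 i2] e2)
    also have "\<dots> \<le> (\<integral>r. \<bar>indicator {0..<d} r * H r - indicator {0..<d} r * c\<bar> \<partial>lebesgue)"
      by (rule integral_abs_bound)
    also have "\<dots> \<le> (\<integral>r. indicator {0..<d} r * (\<bar>c\<bar> / 2) \<partial>lebesgue)"
    proof (intro integral_mono i2 integrable_abs Bochner_Integration.integrable_diff i1)
      fix r :: real
      show "\<bar>indicator {0..<d} r * H r - indicator {0..<d} r * c\<bar> \<le> indicator {0..<d} r * (\<bar>c\<bar> / 2)"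
        using d(2)[of r] H_pos[of r] by (auto simp: indicator_def)
    qed
    also have "\<dots> = d * (\<bar>c\<bar> / 2)" by (rule e2)
    finally have *: "\<bar>(\<integral>r. indicator {0..<d} r * H r \<partial>lebesgue) - d * c\<bar> \<le> d * (\<bar>c\<bar> / 2)" .
    have "d * (\<bar>c\<bar> / 2) < \<bar>d * c\<bar>"
      using d(1) x(2) by (simp add: c_def abs_mult)
    with * show ?thesis by auto
  qed
  then have "\<forall>\<^sub>F k in sequentially. (\<integral>r. indicator (E (real (Suc k))) r * H r \<partial>lebesgue) \<noteq> 0"
    using lim by (rule tendsto_imp_eventually_ne[rotated])
  then obtain k where k: "(\<integral>r. indicator (E (real (Suc k))) r * H r \<partial>lebesgue) \<noteq> 0"
    by (auto simp: eventually_sequentially)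
  obtain y where "y \<in> V" "\<forall>n. W (real n * real (Suc k)) y = (\<integral>r. indicator (E (real (Suc k))) r * H r \<partial>lebesgue)"
    using average[of "real (Suc k)"] by auto
  then show ?thesis
    using k by (intro integrable_weight_if_periodic_windows[of y "real (Suc k)", OF _ _ k]) (auto simp: W_def)
qed

end

section \<open>Test functions and Pettis integrals for an integrable weight\<close>

text \<open>
  Test functions vanish on the negative half-line as functions on the whole line. Hence their
  translates to the right are continuous in both the shift and the point.
\<close>

definition test_functions :: "(real \<Rightarrow> real) set" where
  "test_functions = {f. continuous_on UNIV f \<and> (\<exists>b. \<forall>x. x \<notin> {0..b} \<longrightarrow> f x = 0)}"

lemma test_function_bounds:
  assumes "f \<in> test_functions"
  shows "\<exists>b\<ge>0. \<exists>B\<ge>0. (\<forall>x. x \<notin> {0..b} \<longrightarrow> f x = 0) \<and> (\<forall>x. \<bar>f x\<bar> \<le> B)"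
proof -
  obtain b where b: "\<And>x. x \<notin> {0..b} \<Longrightarrow> f x = 0" and cont: "continuous_on UNIV f"
    using assms by (auto simp: test_functions_def)
  have "compact (f ` {0..max 0 b})"
    by (intro compact_continuous_image continuous_on_subset[OF cont]) auto
  then obtain B where "\<forall>y\<in>f ` {0..max 0 b}. norm y \<le> B"
    using compact_imp_bounded bounded_iff by metis
  then have B: "\<bar>f x\<bar> \<le> B" if "x \<in> {0..max 0 b}" for x
    using that by simp
  have "\<bar>f x\<bar> \<le> B" for x
  proof (cases "x \<in> {0..max 0 b}")
    case False
    then have "f x = 0" by (intro b) auto
    then show ?thesis using B[of 0] by simp
  qed (rule B)
  moreover have "0 \<le> B" using B[of 0] by simp
  moreover have "f x = 0" if "x \<notin> {0..max 0 b}" for x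
    using that by (intro b) auto
  ultimately show ?thesis
    by (intro exI[of _ "max 0 b"] exI[of _ B] conjI allI impI) simp_all
qed

lemma continuous_measurable_halfline:
  fixes f :: "real \<Rightarrow> real"
  assumes "continuous_on UNIV f"
  shows "f \<in> borel_measurable halfline"
  using assms
  by (intro measurable_restrict_space1 measurable_completion) (simp add: borel_measurable_continuous_onI)

text \<open>
  The sums depend linearly on finitely many values of \<open>F\<close>, with weights that do not depend on \<open>F\<close>.
  Therefore the same sums can be formed for a vector-valued function and for its image under a
  functional.
\<close>

lemma riemann_sum_tendsto:
  fixes F :: "real \<Rightarrow> real"
  assumes E: "E \<in> sets lebesgue" "E \<subseteq> {0..R}"
    and F: "continuous_on UNIV F" "\<And>t. \<bar>F t\<bar> \<le> D"
  defines "I \<equiv> \<lambda>n k. E \<inter> {t. \<lfloor>real (Suc n) * t\<rfloor> = int k}"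
  defines "s \<equiv> \<lambda>n F. \<Sum>k<Suc (nat \<lfloor>real (Suc n) * R\<rfloor>). measure lebesgue (I n k) * F (real k / real (Suc n))"
  shows "(\<lambda>n. s n F) \<longlonglongrightarrow> (\<integral>t. F t \<partial>lebesgue_on E)"
    and "\<bar>s n F\<bar> \<le> D * measure lebesgue E"
proof -
  define G where "G n t = (\<Sum>k<Suc (nat \<lfloor>real (Suc n) * R\<rfloor>). indicator (I n k) t * F (real k / real (Suc n)))" for n t
  have D: "0 \<le> D" using F(2)[of 0] by simp
  have E_fin: "emeasure lebesgue E < \<infinity>"
    using emeasure_mono[OF E(2), of lebesgue]
    by (rule order.strict_trans1) (simp_all add: emeasure_lborel_Icc_eq)
  have I_meas: "I n k \<in> sets lebesgue" for n k
  proof -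
    have "{t. \<lfloor>real (Suc n) * t\<rfloor> = int k} \<in> sets borel" by measurable
    then show ?thesis unfolding I_def using E(1) by auto
  qed
  have I_int: "integrable lebesgue (indicator (I n k) :: real \<Rightarrow> real)" for n k
  proof (rule integrable_real_indicator[OF I_meas])
    show "emeasure lebesgue (I n k) < \<infinity>"
      using emeasure_mono[of "I n k" E lebesgue] E(1) E_fin by (auto simp: I_def intro: order.strict_trans1)
  qed
  have G_int: "integrable lebesgue (G n)" for n
    unfolding G_def[abs_def] by (intro Bochner_Integration.integrable_sum integrable_mult_left I_int)
  have G_integral: "(\<integral>t. G n t \<partial>lebesgue) = s n F" for n
    unfolding G_def s_def using I_int I_meas by (subst Bochner_Integration.integral_sum) auto
  have G_eq: "G n t = indicator E t * F (real (nat \<lfloor>real (Suc n) * t\<rfloor>) / real (Suc n))" for n t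
  proof (cases "t \<in> E")
    case True
    then have t: "0 \<le> t" "t \<le> R" using E(2) by auto
    then have "real (Suc n) * t \<le> real (Suc n) * R" by (intro mult_left_mono) auto
    then have less: "nat \<lfloor>real (Suc n) * t\<rfloor> < Suc (nat \<lfloor>real (Suc n) * R\<rfloor>)"
      by (intro le_imp_less_Suc nat_mono floor_mono)
    have "0 \<le> \<lfloor>real (Suc n) * t\<rfloor>" using t by simp
    then have "indicator (I n k) t = (if k = nat \<lfloor>real (Suc n) * t\<rfloor> then 1 else 0 :: real)" for k
      using True by (auto simp: I_def indicator_def)
    then have "G n t = (\<Sum>k<Suc (nat \<lfloor>real (Suc n) * R\<rfloor>). if k = nat \<lfloor>real (Suc n) * t\<rfloor> then F (real k / real (Suc n)) else 0)"
      unfolding G_def by (intro sum.cong) auto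
    then show ?thesis
      using True less by (simp only: sum.delta finite_lessThan lessThan_iff if_True) simp
  next
    case False
    then show ?thesis by (simp add: G_def I_def)
  qed
  have G_le: "\<bar>G n t\<bar> \<le> D * indicator E t" for n t
    unfolding G_eq using F(2) by (auto simp: indicator_def)
  have D_int: "integrable lebesgue (\<lambda>t. D * indicator E t)"
    using E(1) E_fin by auto
  show "\<bar>s n F\<bar> \<le> D * measure lebesgue E"
  proof -
    have "\<bar>s n F\<bar> \<le> (\<integral>t. \<bar>G n t\<bar> \<partial>lebesgue)"
      unfolding G_integral[symmetric] by (rule integral_abs_bound)
    also have "\<dots> \<le> (\<integral>t. D * indicator E t \<partial>lebesgue)"
      using G_int G_le D_int by (intro integral_mono) auto
    also have "\<dots> = D * measure lebesgue E" using E(1) by simp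
    finally show ?thesis .
  qed
  have F_meas: "F \<in> borel_measurable lebesgue"
    using F(1) by (intro measurable_completion) (simp add: borel_measurable_continuous_onI)
  have "(\<lambda>n. \<integral>t. G n t \<partial>lebesgue) \<longlonglongrightarrow> (\<integral>t. indicator E t * F t \<partial>lebesgue)"
  proof (rule integral_dominated_convergence[OF _ _ D_int])
    show "(\<lambda>t. indicator E t * F t) \<in> borel_measurable lebesgue"
      using F_meas E(1) by (intro borel_measurable_times borel_measurable_indicator)
    show "G n \<in> borel_measurable lebesgue" for n using G_int by auto
    show "AE t in lebesgue. norm (G n t) \<le> D * indicator E t" for n
      using G_le by (intro AE_I2) simp
    show "AE t in lebesgue. (\<lambda>n. G n t) \<longlonglongrightarrow> indicator E t * F t"
    proof (rule AE_I2)
      fix t :: real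
      show "(\<lambda>n. G n t) \<longlonglongrightarrow> indicator E t * F t"
      proof (cases "t \<in> E")
        case True
        then have t: "0 \<le> t" using E(2) by auto
        have "(\<lambda>n. real (nat \<lfloor>real (Suc n) * t\<rfloor>) / real (Suc n)) \<longlonglongrightarrow> t"
        proof (rule tendsto_sandwich)
          have *: "real (nat \<lfloor>real (Suc n) * t\<rfloor>) = of_int \<lfloor>real (Suc n) * t\<rfloor>" for n
            using t by simp
          show "\<forall>\<^sub>F n in sequentially. t - inverse (real (Suc n)) \<le> real (nat \<lfloor>real (Suc n) * t\<rfloor>) / real (Suc n)"
          proof (intro always_eventually allI)
            fix n
            have "real (Suc n) * t - 1 \<le> of_int \<lfloor>real (Suc n) * t\<rfloor>" by linarith
            then have "(real (Suc n) * t - 1) / real (Suc n) \<le> of_int \<lfloor>real (Suc n) * t\<rfloor> / real (Suc n)"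
              by (rule divide_right_mono) simp
            then show "t - inverse (real (Suc n)) \<le> real (nat \<lfloor>real (Suc n) * t\<rfloor>) / real (Suc n)"
              unfolding * by (simp add: diff_divide_distrib inverse_eq_divide del: of_nat_Suc)
          qed
          show "\<forall>\<^sub>F n in sequentially. real (nat \<lfloor>real (Suc n) * t\<rfloor>) / real (Suc n) \<le> t"
          proof (intro always_eventually allI)
            fix n
            have "of_int \<lfloor>real (Suc n) * t\<rfloor> / real (Suc n) \<le> (real (Suc n) * t) / real (Suc n)"
              by (rule divide_right_mono) auto
            then show "real (nat \<lfloor>real (Suc n) * t\<rfloor>) / real (Suc n) \<le> t"
              unfolding * by (simp del: of_nat_Suc)
          qed
          show "(\<lambda>n. t - inverse (real (Suc n))) \<longlonglongrightarrow> t"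
            using tendsto_diff[OF tendsto_const[of t] LIMSEQ_inverse_real_of_nat] by simp
        qed auto
        moreover have "isCont F t" using F(1) by (simp add: continuous_on_eq_continuous_at)
        ultimately show ?thesis
          unfolding G_eq by (intro tendsto_mult tendsto_const isCont_tendsto_compose[of t F])
      next
        case False
        then show ?thesis by (simp add: G_eq)
      qed
    qed
  qed
  then show "(\<lambda>n. s n F) \<longlonglongrightarrow> (\<integral>t. F t \<partial>lebesgue_on E)"
    using E(1) by (simp add: G_integral integral_restrict_space)
qed

locale integrable_weight_Lp = admissible_Lp +
  assumes weight_integrable: "integrable halfline \<rho>"
begin

lemma bounded_in_V:
  assumes f[measurable]: "f \<in> borel_measurable halfline" and bd: "\<And>t. 0 \<le> t \<Longrightarrow> \<bar>f t\<bar> \<le> B"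
  shows "abs_ae_fun f \<in> V" and "N (abs_ae_fun f) \<le> B * (integral\<^sup>L halfline \<rho>) powr (1 / p)"
proof -
  have B: "0 \<le> B" using bd[of 0] by simp
  have le: "\<bar>f t\<bar> powr p * \<rho> t \<le> B powr p * \<rho> t" if "0 \<le> t" for t
    using bd[OF that] weight_pos[OF that] one_le_p by (intro mult_right_mono powr_mono2) auto
  have int: "integrable halfline (\<lambda>t. \<bar>f t\<bar> powr p * \<rho> t)"
  proof (rule Bochner_Integration.integrable_bound)
    show "integrable halfline (\<lambda>t. B powr p * \<rho> t)" using weight_integrable by simp
    show "AE t in halfline. norm (\<bar>f t\<bar> powr p * \<rho> t) \<le> norm (B powr p * \<rho> t)"
    proof (rule AE_I2)
      fix t :: real assume "t \<in> space halfline"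
      then show "norm (\<bar>f t\<bar> powr p * \<rho> t) \<le> norm (B powr p * \<rho> t)"
        using le[of t] weight_pos[of t] by (simp add: abs_mult)
    qed
  qed measurable
  then show "abs_ae_fun f \<in> V" by (simp add: Lp_abs_iff)
  have "(\<integral>t. \<bar>f t\<bar> powr p * \<rho> t \<partial>halfline) \<le> (\<integral>t. B powr p * \<rho> t \<partial>halfline)"
    using int weight_integrable le by (intro integral_mono) auto
  moreover have "0 \<le> (\<integral>t. \<bar>f t\<bar> powr p * \<rho> t \<partial>halfline)"
    by (intro integral_nonneg_AE AE_I2) (auto simp: weight_pos less_imp_le)
  ultimately have "(\<integral>t. \<bar>f t\<bar> powr p * \<rho> t \<partial>halfline) powr (1 / p) \<le> (B powr p * integral\<^sup>L halfline \<rho>) powr (1 / p)"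
    using one_le_p by (intro powr_mono2) auto
  also have "\<dots> = B * (integral\<^sup>L halfline \<rho>) powr (1 / p)"
    using B one_le_p by (simp add: powr_mult powr_powr)
  finally show "N (abs_ae_fun f) \<le> B * (integral\<^sup>L halfline \<rho>) powr (1 / p)"
    by (simp add: Lp_norm_abs)
qed

lemma bounded_convergence:
  assumes "\<And>n. f n \<in> borel_measurable halfline" "g \<in> borel_measurable halfline"
    and "AE t in halfline. (\<lambda>n. f n t) \<longlonglongrightarrow> g t"
    and bd: "\<And>n t. 0 \<le> t \<Longrightarrow> \<bar>f n t\<bar> \<le> B" "\<And>t. 0 \<le> t \<Longrightarrow> \<bar>g t\<bar> \<le> B"
  shows "(\<lambda>n. N (abs_ae_fun (f n) - abs_ae_fun g)) \<longlonglongrightarrow> 0"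
proof (rule Lp_dominated_convergence[OF assms(1-3)])
  show "integrable halfline (\<lambda>t. (2 * B) powr p * \<rho> t)" using weight_integrable by simp
  show "AE t in halfline. \<bar>f n t - g t\<bar> powr p * \<rho> t \<le> (2 * B) powr p * \<rho> t" for n
  proof (rule AE_I2)
    fix t :: real assume "t \<in> space halfline"
    then have t: "0 \<le> t" by simp
    then have "\<bar>f n t - g t\<bar> \<le> 2 * B" using bd(1)[OF t, of n] bd(2)[OF t] by linarith
    then show "\<bar>f n t - g t\<bar> powr p * \<rho> t \<le> (2 * B) powr p * \<rho> t"
      using weight_pos[OF t] one_le_p by (intro mult_right_mono powr_mono2) auto
  qed
qed

text \<open>
  A measurable function is an almost everywhere limit of continuous functions \<open>g\<^sub>n\<close>. After truncation of
  the values at \<open>k\<close> and multiplication by a continuous cutoff supported in \<open>[0, k]\<close> this limit is bounded,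
  so it holds in norm; the limit in \<open>k\<close> is dominated by \<open>u\<close> itself.
\<close>

lemma dense_test_functions: "dense_subset V N (abs_ae_fun ` test_functions)"
  unfolding dense_subset_iff
proof (intro conjI ballI allI impI)
  show "abs_ae_fun ` test_functions \<subseteq> V"
  proof safe
    fix f assume f: "f \<in> test_functions"
    obtain B where "\<forall>x. \<bar>f x\<bar> \<le> B" using test_function_bounds[OF f] by iprover
    then show "abs_ae_fun f \<in> V"
      using f unfolding test_functions_def
      by (intro bounded_in_V(1)[of f B] continuous_measurable_halfline) simp_all
  qed
  fix u and e :: real assume u: "u \<in> V" and e: "0 < e"
  obtain f where f[measurable]: "f \<in> borel_measurable halfline" and uf: "u = abs_ae_fun f"
    by (rule ae_fun_cases)
  have int: "integrable halfline (\<lambda>t. \<bar>f t\<bar> powr p * \<rho> t)"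
    using u uf f by (simp add: Lp_abs_iff)
  have "f measurable_on {0..}"
    using f by (simp add: measurable_on_iff_borel_measurable)
  then obtain Z g where Z: "negligible Z" and g: "\<And>n. continuous_on UNIV (g n)"
    "\<And>x. x \<notin> Z \<Longrightarrow> (\<lambda>n. g n x) \<longlonglongrightarrow> (if x \<in> {0..} then f x else 0)"
    unfolding measurable_on_def by blast
  have AE_Z: "AE t in halfline. t \<notin> Z"
  proof -
    have "AE t in lebesgue. t \<notin> Z"
      using Z by (intro AE_not_in) (simp add: negligible_iff_null_sets)
    then show ?thesis by (simp add: AE_restrict_space_iff eventually_mono)
  qed
  have AE_0: "AE t in halfline. t \<noteq> 0"
  proof -
    have "AE t in lebesgue. t \<notin> {0::real}"
      by (intro AE_not_in) (auto simp: negligible_iff_null_sets[symmetric])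
    then show ?thesis by (simp add: AE_restrict_space_iff eventually_mono)
  qed
  define cut where "cut k x = max 0 (min 1 (min (real k * x) (real k - x)))" for k :: nat and x :: real
  define cl where "cl k y = max (- real k) (min (real k) y)" for k :: nat and y :: real
  \<comment> \<open>First \<open>n\<close>, then \<open>k\<close> tends to infinity: \<open>h k n\<close> tends to \<open>v k\<close>, and \<open>v k\<close> to \<open>f\<close>.\<close>
  define h where "h k n x = cut k x * cl k (g n x)" for k n x
  define v where "v k x = cut k x * cl k (f x)" for k x
  have cut_cont: "continuous_on UNIV (cut k)" for k
    unfolding cut_def by (intro continuous_intros)
  have cut_range: "0 \<le> cut k x" "cut k x \<le> 1" for k x by (auto simp: cut_def)
  have h_cont: "continuous_on UNIV (h k n)" for k n
    unfolding h_def cl_def by (intro continuous_intros cut_cont g)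
  have h_test: "h k n \<in> test_functions" for k n
  proof -
    have "h k n x = 0" if "x \<notin> {0..real k}" for x
    proof -
      have "real k * x \<le> 0 \<or> real k - x \<le> 0"
        using that by (auto simp: mult_le_0_iff)
      then show ?thesis by (auto simp: h_def cut_def)
    qed
    then show ?thesis using h_cont by (auto simp: test_functions_def)
  qed
  have cut_meas[measurable]: "cut k \<in> borel_measurable halfline" for k
    by (rule continuous_measurable_halfline) fact
  have h_meas: "h k n \<in> borel_measurable halfline" for k n
    by (rule continuous_measurable_halfline) fact
  have v_meas: "v k \<in> borel_measurable halfline" for k
    unfolding v_def cl_def by measurable
  have bd: "\<bar>cut k x * cl k y\<bar> \<le> real k" for k x y
  proof -
    have "\<bar>cut k x\<bar> * \<bar>cl k y\<bar> \<le> 1 * real k"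
      using cut_range[of k x] by (intro mult_mono) (auto simp: cl_def)
    then show ?thesis by (simp add: abs_mult)
  qed
  have hv: "(\<lambda>n. N (abs_ae_fun (h k n) - abs_ae_fun (v k))) \<longlonglongrightarrow> 0" for k
  proof (rule bounded_convergence[OF h_meas v_meas])
    show "\<bar>h k n t\<bar> \<le> real k" "\<bar>v k t\<bar> \<le> real k" for n t by (simp_all add: h_def v_def bd)
    have "AE t in halfline. 0 \<le> t" by (intro AE_I2) auto
    with AE_Z show "AE t in halfline. (\<lambda>n. h k n t) \<longlonglongrightarrow> v k t"
    proof eventually_elim
      case (elim t)
      then have "(\<lambda>n. g n t) \<longlonglongrightarrow> f t" using g(2)[of t] by simp
      then show ?case unfolding h_def v_def cl_def by (intro tendsto_intros)
    qed
  qed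
  have vf: "(\<lambda>k. N (abs_ae_fun (v k) - abs_ae_fun f)) \<longlonglongrightarrow> 0"
  proof (rule Lp_dominated_convergence[OF v_meas f _ int])
    have "AE t in halfline. 0 \<le> t" by (intro AE_I2) auto
    with AE_0 show "AE t in halfline. (\<lambda>k. v k t) \<longlonglongrightarrow> f t"
    proof eventually_elim
      case (elim t)
      have "\<forall>\<^sub>F k in sequentially. max (1 / t) (max (t + 1) \<bar>f t\<bar>) \<le> real k"
        using eventually_ge_at_top[of "nat \<lceil>max (1 / t) (max (t + 1) \<bar>f t\<bar>)\<rceil>"]
      proof eventually_elim
        case (elim k)
        then show ?case using real_nat_ceiling_ge[of "max (1 / t) (max (t + 1) \<bar>f t\<bar>)"] by linarith
      qed
      then have "\<forall>\<^sub>F k in sequentially. v k t = f t"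
      proof eventually_elim
        case (elim k)
        then have "1 \<le> real k * t" using \<open>t \<noteq> 0\<close> \<open>0 \<le> t\<close> by (simp add: field_simps)
        then have "cut k t = 1" using elim by (simp add: cut_def)
        moreover have "cl k (f t) = f t" using elim by (auto simp: cl_def)
        ultimately show ?case by (simp add: v_def)
      qed
      then show ?case by (rule tendsto_eventually)
    qed
    show "AE t in halfline. \<bar>v k t - f t\<bar> powr p * \<rho> t \<le> \<bar>f t\<bar> powr p * \<rho> t" for k
    proof (rule AE_I2)
      fix t :: real assume "t \<in> space halfline"
      then have t: "0 \<le> t" by simp
      have between: "\<bar>a * y - z\<bar> \<le> \<bar>z\<bar>"
        if "0 \<le> a" "a \<le> 1" "(0 \<le> y \<and> y \<le> z) \<or> (z \<le> y \<and> y \<le> 0)" for a y z :: real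
      proof -
        have "\<bar>a * y\<bar> \<le> \<bar>y\<bar>" using that by (simp add: abs_mult mult_left_le_one_le)
        moreover have "0 \<le> y \<Longrightarrow> 0 \<le> a * y" "y \<le> 0 \<Longrightarrow> a * y \<le> 0"
          using that by (auto simp: mult_nonneg_nonpos)
        ultimately show ?thesis using that(3) by (auto simp: abs_if split: if_splits)
      qed
      have "\<bar>v k t - f t\<bar> \<le> \<bar>f t\<bar>"
        unfolding v_def using cut_range[of k t] by (intro between) (auto simp: cl_def)
      then show "\<bar>v k t - f t\<bar> powr p * \<rho> t \<le> \<bar>f t\<bar> powr p * \<rho> t"
        using weight_pos[OF t] one_le_p by (intro mult_right_mono powr_mono2) auto
    qed
  qed
  obtain k where k: "N (abs_ae_fun (v k) - u) < e / 2"
    using eventually_happens'[OF sequentially_bot order_tendstoD(2)[OF vf half_gt_zero[OF e]]] uf by blast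
  obtain n where n: "N (abs_ae_fun (h k n) - abs_ae_fun (v k)) < e / 2"
    using eventually_happens'[OF sequentially_bot order_tendstoD(2)[OF hv half_gt_zero[OF e]]] by blast
  have hV: "abs_ae_fun (h k n) \<in> V"
  proof (rule bounded_in_V(1)[where f = "h k n" and B = "real k"])
    show "\<bar>h k n t\<bar> \<le> real k" for t unfolding h_def by (rule bd)
  qed (rule h_meas)
  have vV: "abs_ae_fun (v k) \<in> V"
  proof (rule bounded_in_V(1)[where f = "v k" and B = "real k"])
    show "\<bar>v k t\<bar> \<le> real k" for t unfolding v_def by (rule bd)
  qed (rule v_meas)
  have "N (u - abs_ae_fun (h k n)) < e"
    using triangle[OF u vV hV] k n commute[of u "abs_ae_fun (v k)"]
      commute[of "abs_ae_fun (v k)" "abs_ae_fun (h k n)"] by linarith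
  then show "\<exists>v\<in>abs_ae_fun ` test_functions. N (u - v) < e"
    using h_test by blast
qed

text \<open>
  Over a bounded set \<open>E\<close> of parameters, Riemann sums converge on both sides of
  \<open>\<phi> (\<integral>\<^sub>E K\<^sub>t dt) = \<integral>\<^sub>E \<phi> (K\<^sub>t) dt\<close>, where the left-hand integral is taken pointwise. Taking for \<open>E\<close> the
  set where \<open>\<phi> (K\<^sub>t)\<close> has a given sign bounds the integral of its absolute value, since
  \<open>\<integral> \<bar>K\<^sub>t x\<bar> dt\<close> is bounded uniformly in \<open>x\<close> and constants belong to the space. Unbounded sets follow
  by dominated convergence.
\<close>

lemma Pettis_integrable_kernel:
  fixes K :: "real \<Rightarrow> real \<Rightarrow> real"
  assumes cont: "\<And>x. continuous_on UNIV (\<lambda>t. K t x)"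
    and meas: "\<And>t. K t \<in> borel_measurable halfline"
    and bound: "\<And>t x. \<bar>K t x\<bar> \<le> B"
    and int: "\<And>x. 0 \<le> x \<Longrightarrow> integrable halfline (\<lambda>t. K t x)"
    and C: "\<And>x. 0 \<le> x \<Longrightarrow> (\<integral>t. \<bar>K t x\<bar> \<partial>halfline) \<le> C"
  shows "Pettis_integrable V N (\<lambda>t. abs_ae_fun (K t))"
proof -
  define \<xi> where "\<xi> E x = (\<integral>t. K t x \<partial>lebesgue_on E)" for E x
  have KV: "abs_ae_fun (K t) \<in> V" for t
    by (rule bounded_in_V(1)[OF meas bound])
  have intE: "integrable lebesgue (\<lambda>t. indicator E t * K t x)"
    if "E \<in> sets lebesgue" "E \<subseteq> {0..}" "0 \<le> x" for E x
  proof -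
    have "integrable lebesgue (\<lambda>t. indicator E t *\<^sub>R (indicator {0..} t * K t x))"
      using int[OF that(3)] that(1) by (intro integrable_mult_indicator) (simp_all add: halfline_integrable_iff)
    moreover have "(\<lambda>t. indicator E t *\<^sub>R (indicator {0..} t * K t x)) = (\<lambda>t. indicator E t * K t x)"
      using that(2) by (auto simp: indicator_def fun_eq_iff)
    ultimately show ?thesis by simp
  qed
  have \<xi>_le: "\<bar>\<xi> E x\<bar> \<le> C" if E: "E \<in> sets lebesgue" "E \<subseteq> {0..}" and x: "0 \<le> x" for E x
  proof -
    have "\<bar>\<xi> E x\<bar> \<le> (\<integral>t. \<bar>indicator E t * K t x\<bar> \<partial>lebesgue)"
      unfolding \<xi>_def integral_lebesgue_on[OF E(1)] by (rule integral_abs_bound)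
    also have "\<dots> \<le> (\<integral>t. indicator {0..} t * \<bar>K t x\<bar> \<partial>lebesgue)"
    proof (rule integral_mono)
      show "integrable lebesgue (\<lambda>t. \<bar>indicator E t * K t x\<bar>)" using intE[OF E x] by (rule integrable_abs)
      show "integrable lebesgue (\<lambda>t. indicator {0..} t * \<bar>K t x\<bar>)"
        using int[OF x] by (simp flip: halfline_integrable_iff)
      show "\<bar>indicator E t * K t x\<bar> \<le> indicator {0..} t * \<bar>K t x\<bar>" for t
        using E(2) by (auto simp: indicator_def)
    qed
    also have "\<dots> \<le> C" using C[OF x] by (simp add: halfline_integral_eq)
    finally show ?thesis .
  qed
  define h where "h \<phi> t = \<phi> (abs_ae_fun (K t))" for \<phi> :: "ae_fun \<Rightarrow> real" and t
  have h_cont: "continuous_on UNIV (h \<phi>)" if \<phi>: "\<phi> \<in> dual_space V N" for \<phi>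
    unfolding continuous_on_sequentially
  proof (intro allI ballI impI)
    fix r :: "nat \<Rightarrow> real" and a assume "(\<forall>n. r n \<in> UNIV) \<and> r \<longlonglongrightarrow> a"
    then have "(\<lambda>n. K (r n) x) \<longlonglongrightarrow> K a x" for x
      using cont[of x] by (auto simp: continuous_on_sequentially comp_def)
    then have "(\<lambda>n. N (abs_ae_fun (K (r n)) - abs_ae_fun (K a))) \<longlonglongrightarrow> 0"
      by (intro bounded_convergence[where B = B] meas bound) auto
    then show "(h \<phi> \<circ> r) \<longlonglongrightarrow> h \<phi> a"
      unfolding h_def comp_def by (intro dual_tendsto[OF \<phi>] KV)
  qed
  have h_meas: "h \<phi> \<in> borel_measurable lebesgue" if \<phi>: "\<phi> \<in> dual_space V N" for \<phi>
    using h_cont[OF \<phi>] by (intro measurable_completion) (simp add: borel_measurable_continuous_onI)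
  have step: "\<xi> E \<in> borel_measurable halfline \<and> (\<forall>\<phi>\<in>dual_space V N. \<phi> (abs_ae_fun (\<xi> E)) = (\<integral>t. h \<phi> t \<partial>lebesgue_on E))"
    if E: "E \<in> sets lebesgue" "E \<subseteq> {0..R}" for E R
  proof -
    define \<mu> where "\<mu> n k = measure lebesgue (E \<inter> {t. \<lfloor>real (Suc n) * t\<rfloor> = int k})" for n k
    define m where "m n = Suc (nat \<lfloor>real (Suc n) * R\<rfloor>)" for n
    define X where "X n x = (\<Sum>k<m n. \<mu> n k * K (real k / real (Suc n)) x)" for n x
    have X_lim: "(\<lambda>n. X n x) \<longlonglongrightarrow> \<xi> E x" and X_le: "\<bar>X n x\<bar> \<le> B * measure lebesgue E" for n x
      unfolding X_def \<xi>_def \<mu>_def m_def by (rule riemann_sum_tendsto[OF E cont bound])+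
    have X_meas: "X n \<in> borel_measurable halfline" for n
      unfolding X_def by (intro borel_measurable_sum borel_measurable_times meas) auto
    have \<xi>_meas: "\<xi> E \<in> borel_measurable halfline"
      by (rule borel_measurable_LIMSEQ_real[OF X_lim X_meas])
    have \<xi>_le': "\<bar>\<xi> E x\<bar> \<le> B * measure lebesgue E" for x
      by (rule LIMSEQ_le_const2[OF tendsto_rabs[OF X_lim]]) (use X_le in auto)
    have conv: "(\<lambda>n. N (abs_ae_fun (X n) - abs_ae_fun (\<xi> E))) \<longlonglongrightarrow> 0"
      by (rule bounded_convergence[OF X_meas \<xi>_meas _ X_le \<xi>_le']) (auto intro: AE_I2 X_lim)
    have XV: "abs_ae_fun (X n) \<in> V" for n by (rule bounded_in_V(1)[OF X_meas X_le])
    have \<xi>V: "abs_ae_fun (\<xi> E) \<in> V" by (rule bounded_in_V(1)[OF \<xi>_meas \<xi>_le'])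
    have "\<phi> (abs_ae_fun (\<xi> E)) = (\<integral>t. h \<phi> t \<partial>lebesgue_on E)" if \<phi>: "\<phi> \<in> dual_space V N" for \<phi>
    proof -
      obtain Q where Q: "0 < Q" "\<And>u. u \<in> V \<Longrightarrow> \<bar>\<phi> u\<bar> \<le> Q * N u"
        using dual_bounded[OF \<phi>] by blast
      have h_le: "\<bar>h \<phi> t\<bar> \<le> Q * (B * (integral\<^sup>L halfline \<rho>) powr (1 / p))" for t
        unfolding h_def using Q(1) bounded_in_V(2)[OF meas[of t] bound]
        by (intro order_trans[OF Q(2)[OF KV]] mult_left_mono) auto
      have "\<phi> (abs_ae_fun (X n)) = (\<Sum>k<m n. \<mu> n k * h \<phi> (real k / real (Suc n)))" for n
      proof -
        have "abs_ae_fun (X n) = (\<Sum>k<m n. \<mu> n k *\<^sub>R abs_ae_fun (K (real k / real (Suc n))))"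
          unfolding X_def by (rule abs_ae_fun_sum[symmetric]) (auto intro: meas)
        then show ?thesis
          using dual_sum[OF \<phi>, of "{..<m n}" "\<lambda>k. abs_ae_fun (K (real k / real (Suc n)))" "\<mu> n"] KV
          by (simp add: h_def)
      qed
      then have "(\<lambda>n. \<phi> (abs_ae_fun (X n))) \<longlonglongrightarrow> (\<integral>t. h \<phi> t \<partial>lebesgue_on E)"
        using riemann_sum_tendsto(1)[OF E h_cont[OF \<phi>] h_le] unfolding \<mu>_def m_def by simp
      moreover have "(\<lambda>n. \<phi> (abs_ae_fun (X n))) \<longlonglongrightarrow> \<phi> (abs_ae_fun (\<xi> E))"
        by (rule dual_tendsto[OF \<phi> XV \<xi>V conv])
      ultimately show ?thesis by (rule LIMSEQ_unique[rotated])
    qed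
    then show ?thesis using \<xi>_meas by blast
  qed
  have h_int: "integrable halfline (h \<phi>)" if \<phi>: "\<phi> \<in> dual_space V N" for \<phi>
  proof -
    obtain Q where Q: "0 < Q" "\<And>u. u \<in> V \<Longrightarrow> \<bar>\<phi> u\<bar> \<le> Q * N u"
      using dual_bounded[OF \<phi>] by blast
    define D where "D = Q * (C * (integral\<^sup>L halfline \<rho>) powr (1 / p))"
    have le_D: "\<bar>\<integral>t. h \<phi> t \<partial>lebesgue_on E\<bar> \<le> D" if E: "E \<in> sets lebesgue" "E \<subseteq> {0..R}" for E R
    proof -
      have E0: "E \<subseteq> {0..}" using E(2) by auto
      have "abs_ae_fun (\<xi> E) \<in> V" "N (abs_ae_fun (\<xi> E)) \<le> C * (integral\<^sup>L halfline \<rho>) powr (1 / p)"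
        using step[OF E] bounded_in_V[of "\<xi> E" C] \<xi>_le[OF E(1) E0] by auto
      then have "\<bar>\<phi> (abs_ae_fun (\<xi> E))\<bar> \<le> D"
        unfolding D_def using Q(1) by (intro order_trans[OF Q(2)] mult_left_mono) auto
      then show ?thesis using step[OF E] \<phi> by simp
    qed
    \<comment> \<open>The integral of \<open>\<bar>\<phi> (K\<^sub>t)\<bar>\<close> over \<open>[0, n]\<close> is split by the sign of \<open>\<phi> (K\<^sub>t)\<close>.\<close>
    define P where "P n = {0..real n} \<inter> {t. 0 < h \<phi> t}" for n
    define M where "M n = {0..real n} \<inter> {t. h \<phi> t \<le> 0}" for n
    have PM: "P n \<in> sets lebesgue" "M n \<in> sets lebesgue" "P n \<subseteq> {0..real n}" "M n \<subseteq> {0..real n}" for n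
    proof -
      have "{t. 0 < h \<phi> t} \<in> sets lebesgue" "{t. h \<phi> t \<le> 0} \<in> sets lebesgue"
        using measurable_sets[OF h_meas[OF \<phi>], of "{0<..}"] measurable_sets[OF h_meas[OF \<phi>], of "{..0}"]
        by (simp_all add: vimage_def)
      then show "P n \<in> sets lebesgue" "M n \<in> sets lebesgue" "P n \<subseteq> {0..real n}" "M n \<subseteq> {0..real n}"
        by (auto simp: P_def M_def)
    qed
    define a where "a n t = indicator {0..real n} t * \<bar>h \<phi> t\<bar>" for n t
    have bd_int: "integrable lebesgue (\<lambda>t. indicator E t * h \<phi> t)" if "E \<in> sets lebesgue" "E \<subseteq> {0..R}" for E R
    proof -
      have "(h \<phi>) absolutely_integrable_on {0..R}"
        by (intro absolutely_integrable_continuous_real continuous_on_subset[OF h_cont[OF \<phi>]]) auto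
      then have "(h \<phi>) absolutely_integrable_on E"
        using that by (rule set_integrable_subset)
      then show ?thesis by (simp add: set_integrable_def)
    qed
    have a_eq: "a n t = indicator (P n) t * h \<phi> t - indicator (M n) t * h \<phi> t" for n t
      by (auto simp: a_def P_def M_def indicator_def)
    have a_int: "integrable lebesgue (a n)" for n
      unfolding a_eq using bd_int[OF PM(1,3)] bd_int[OF PM(2,4)] by auto
    have a_le: "(\<integral>t. a n t \<partial>lebesgue) \<le> 2 * D" for n
    proof -
      have "(\<integral>t. a n t \<partial>lebesgue) = (\<integral>t. h \<phi> t \<partial>lebesgue_on (P n)) - (\<integral>t. h \<phi> t \<partial>lebesgue_on (M n))"
        unfolding a_eq using bd_int[OF PM(1,3)] bd_int[OF PM(2,4)] PM
        by (simp add: integral_restrict_space Bochner_Integration.integral_diff)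
      then show ?thesis
        using le_D[OF PM(1,3), of n] le_D[OF PM(2,4), of n] by linarith
    qed
    have a_mono: "a n t \<le> a n' t" if "n \<le> n'" for n n' t
      using that by (auto simp: a_def indicator_def)
    have "incseq (\<lambda>n. \<integral>t. a n t \<partial>lebesgue)"
      by (intro incseq_SucI integral_mono a_int a_mono) auto
    then obtain L where L: "(\<lambda>n. \<integral>t. a n t \<partial>lebesgue) \<longlonglongrightarrow> L"
      using incseq_convergent[of "\<lambda>n. \<integral>t. a n t \<partial>lebesgue" "2 * D"] a_le by blast
    have "integrable lebesgue (\<lambda>t. indicator {0..} t * \<bar>h \<phi> t\<bar>)"
    proof (rule integrable_monotone_convergence[OF a_int _ _ L])
      show "AE t in lebesgue. mono (\<lambda>n. a n t)" by (intro AE_I2 monoI a_mono)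
      show "AE t in lebesgue. (\<lambda>n. a n t) \<longlonglongrightarrow> indicator {0..} t * \<bar>h \<phi> t\<bar>"
      proof (intro AE_I2 tendsto_eventually)
        fix t :: real
        show "\<forall>\<^sub>F n in sequentially. a n t = indicator {0..} t * \<bar>h \<phi> t\<bar>"
          using eventually_ge_at_top[of "nat \<lceil>t\<rceil>"]
          by eventually_elim (auto simp: a_def indicator_def nat_le_iff ceiling_le_iff)
      qed
      show "(\<lambda>t. indicator {0..} t * \<bar>h \<phi> t\<bar>) \<in> borel_measurable lebesgue"
        using h_meas[OF \<phi>] by (intro borel_measurable_times borel_measurable_indicator borel_measurable_abs) auto
    qed
    then have "integrable halfline (\<lambda>t. \<bar>h \<phi> t\<bar>)" by (simp add: halfline_integrable_iff)
    then show ?thesis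
      using h_meas[OF \<phi>] by (subst (asm) integrable_abs_iff) (auto intro: measurable_restrict_space1)
  qed
  have "\<exists>x\<in>V. \<forall>\<phi>\<in>dual_space V N. \<phi> x = (\<integral>t. h \<phi> t \<partial>lebesgue_on E)"
    if E: "E \<in> sets lebesgue" "E \<subseteq> {0..}" for E
  proof -
    define E' where "E' n = E \<inter> {0..real n}" for n
    have E': "E' n \<in> sets lebesgue" "E' n \<subseteq> {0..real n}" "E' n \<subseteq> {0..}" for n
      using E by (auto simp: E'_def)
    have lim: "(\<lambda>n. \<integral>t. F t \<partial>lebesgue_on (E' n)) \<longlonglongrightarrow> (\<integral>t. F t \<partial>lebesgue_on E)"
      if F: "integrable halfline F" for F :: "real \<Rightarrow> real"
    proof -
      have F0: "integrable lebesgue (\<lambda>t. indicator {0..} t * F t)"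
        using F by (simp add: halfline_integrable_iff)
      have FE: "integrable lebesgue (\<lambda>t. indicator A t * F t)" if "A \<in> sets lebesgue" "A \<subseteq> {0..}" for A
      proof -
        have "integrable lebesgue (\<lambda>t. indicator A t *\<^sub>R (indicator {0..} t * F t))"
          using F0 that(1) by (intro integrable_mult_indicator)
        moreover have "(\<lambda>t. indicator A t *\<^sub>R (indicator {0..} t * F t)) = (\<lambda>t. indicator A t * F t)"
          using that(2) by (auto simp: indicator_def fun_eq_iff)
        ultimately show ?thesis by simp
      qed
      have "(\<lambda>n. \<integral>t. indicator (E' n) t * F t \<partial>lebesgue) \<longlonglongrightarrow> (\<integral>t. indicator E t * F t \<partial>lebesgue)"
      proof (rule integral_dominated_convergence[where w = "\<lambda>t. \<bar>indicator E t * F t\<bar>"])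
        show "(\<lambda>t. indicator E t * F t) \<in> borel_measurable lebesgue"
          "(\<lambda>t. indicator (E' n) t * F t) \<in> borel_measurable lebesgue" for n
          using FE[OF E] FE[OF E'(1,3)] by auto
        show "integrable lebesgue (\<lambda>t. \<bar>indicator E t * F t\<bar>)" using FE[OF E] by (rule integrable_abs)
        show "AE t in lebesgue. norm (indicator (E' n) t * F t) \<le> \<bar>indicator E t * F t\<bar>" for n
          by (intro AE_I2) (auto simp: E'_def indicator_def)
        show "AE t in lebesgue. (\<lambda>n. indicator (E' n) t * F t) \<longlonglongrightarrow> indicator E t * F t"
        proof (intro AE_I2 tendsto_eventually)
          fix t :: real
          show "\<forall>\<^sub>F n in sequentially. indicator (E' n) t * F t = indicator E t * F t"
            using eventually_ge_at_top[of "nat \<lceil>t\<rceil>"]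
            by eventually_elim (use E(2) in \<open>auto simp: E'_def indicator_def nat_le_iff ceiling_le_iff\<close>)
        qed
      qed
      then show ?thesis using E(1) E'(1) by (simp add: integral_restrict_space)
    qed
    have \<xi>_lim: "(\<lambda>n. \<xi> (E' n) x) \<longlonglongrightarrow> \<xi> E x" if "0 \<le> x" for x
      unfolding \<xi>_def by (rule lim[OF int[OF that]])
    have \<xi>'_meas: "\<xi> (E' n) \<in> borel_measurable halfline" for n
      using step[OF E'(1,2)] by blast
    have \<xi>_meas: "\<xi> E \<in> borel_measurable halfline"
    proof (rule borel_measurable_LIMSEQ_real)
      show "(\<lambda>n. \<xi> (E' n) x) \<longlonglongrightarrow> \<xi> E x" if "x \<in> space halfline" for x
        using that by (simp add: \<xi>_lim)
    qed (rule \<xi>'_meas)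
    have conv: "(\<lambda>n. N (abs_ae_fun (\<xi> (E' n)) - abs_ae_fun (\<xi> E))) \<longlonglongrightarrow> 0"
    proof (rule bounded_convergence[where f = "\<lambda>n. \<xi> (E' n)" and B = C])
      show "AE x in halfline. (\<lambda>n. \<xi> (E' n) x) \<longlonglongrightarrow> \<xi> E x"
        by (intro AE_I2) (simp add: \<xi>_lim)
    qed (fact \<xi>'_meas \<xi>_meas \<xi>_le[OF E'(1,3)] \<xi>_le[OF E])+
    have \<xi>V: "abs_ae_fun (\<xi> E) \<in> V"
      by (rule bounded_in_V(1)[OF \<xi>_meas, of C]) (rule \<xi>_le[OF E])
    have \<xi>'V: "abs_ae_fun (\<xi> (E' n)) \<in> V" for n
      by (rule bounded_in_V(1)[OF \<xi>'_meas, of n C]) (rule \<xi>_le[OF E'(1,3)])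
    have "\<phi> (abs_ae_fun (\<xi> E)) = (\<integral>t. h \<phi> t \<partial>lebesgue_on E)" if \<phi>: "\<phi> \<in> dual_space V N" for \<phi>
    proof (rule LIMSEQ_unique)
      show "(\<lambda>n. \<phi> (abs_ae_fun (\<xi> (E' n)))) \<longlonglongrightarrow> \<phi> (abs_ae_fun (\<xi> E))"
        by (rule dual_tendsto[OF \<phi> \<xi>'V \<xi>V conv])
      show "(\<lambda>n. \<phi> (abs_ae_fun (\<xi> (E' n)))) \<longlonglongrightarrow> (\<integral>t. h \<phi> t \<partial>lebesgue_on E)"
      proof -
        have "\<phi> (abs_ae_fun (\<xi> (E' n))) = (\<integral>t. h \<phi> t \<partial>lebesgue_on (E' n))" for n
          using step[OF E'(1,2), of n] \<phi> by blast
        then show ?thesis using lim[OF h_int[OF \<phi>]] by simp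
      qed
    qed
    then show ?thesis using \<xi>V by blast
  qed
  then show ?thesis
    using KV h_int unfolding Pettis_integrable_def h_def by simp
qed

end


section \<open>The criterion for an integrable weight\<close>

lemma interval_kernel_integral:
  fixes g :: "real \<Rightarrow> real"
  assumes "continuous_on UNIV g" "0 \<le> b" "0 \<le> B" and "\<And>t. 0 \<le> t \<Longrightarrow> \<bar>g t\<bar> \<le> B * indicator {a..a + b} t"
  shows "integrable halfline g" and "(\<integral>t. \<bar>g t\<bar> \<partial>halfline) \<le> B * b"
proof -
  have le: "\<bar>indicator {0..} t * g t\<bar> \<le> B * indicator {a..a + b} t" for t
    using assms(4)[of t] assms(3) by (auto simp: indicator_def)
  have int: "integrable lebesgue (\<lambda>t. B * indicator {a..a + b} t)"
    by (intro integrable_mult_right integrable_real_indicator) (auto simp: emeasure_lborel_Icc_eq)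
  have "g \<in> borel_measurable lebesgue"
    using assms(1) by (intro measurable_completion) (simp add: borel_measurable_continuous_onI)
  then have meas: "(\<lambda>t. indicator {0..} t * g t) \<in> borel_measurable lebesgue"
    by (intro borel_measurable_times borel_measurable_indicator) auto
  have *: "integrable lebesgue (\<lambda>t. indicator {0..} t * g t)"
    by (rule Bochner_Integration.integrable_bound[OF int meas], rule AE_I2)
      (use le in \<open>auto intro: order_trans[OF _ abs_ge_self]\<close>)
  then show "integrable halfline g" by (simp add: halfline_integrable_iff)
  have "(\<integral>t. \<bar>g t\<bar> \<partial>halfline) = (\<integral>t. \<bar>indicator {0..} t * g t\<bar> \<partial>lebesgue)"
    by (simp add: halfline_integral_eq abs_mult)
  also have "\<dots> \<le> (\<integral>t. B * indicator {a..a + b} t \<partial>lebesgue)"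
    by (rule integral_mono[OF integrable_abs[OF *] int le])
  also have "\<dots> = B * b" using assms(2) by simp
  finally show "(\<integral>t. \<bar>g t\<bar> \<partial>halfline) \<le> B * b" .
qed

context integrable_weight_Lp
begin

lemma Pettis_integrable_test_function:
  assumes f: "f \<in> test_functions"
  shows "Pettis_integrable V N (\<lambda>t. translation t (abs_ae_fun f))"
    and "Pettis_integrable V N (\<lambda>t. abs_ae_fun (\<lambda>x. f (x - t)))"
proof -
  obtain b B where b: "0 \<le> b" and B: "0 \<le> B" and supp: "\<forall>x. x \<notin> {0..b} \<longrightarrow> f x = 0" and bd: "\<forall>x. \<bar>f x\<bar> \<le> B"
    using test_function_bounds[OF f] by iprover
  have cont: "continuous_on UNIV f" using f by (simp add: test_functions_def)
  have cont': "continuous_on UNIV (\<lambda>t. f (g t))" if "continuous_on UNIV g" for g :: "real \<Rightarrow> real"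
    by (rule continuous_on_compose2[OF cont that]) simp
  have meas: "f \<in> borel_measurable halfline" by (rule continuous_measurable_halfline[OF cont])
  have fle: "\<bar>f y\<bar> \<le> B * indicator {0..b} y" for y
    using bd supp by (auto simp: indicator_def)
  show "Pettis_integrable V N (\<lambda>t. abs_ae_fun (\<lambda>x. f (x - t)))"
  proof (rule Pettis_integrable_kernel[where K = "\<lambda>t x. f (x - t)" and B = B and C = "B * b"])
    show "continuous_on UNIV (\<lambda>t. f (x - t))" for x by (intro cont' continuous_intros)
    show "(\<lambda>x. f (x - t)) \<in> borel_measurable halfline" for t
      by (intro continuous_measurable_halfline cont' continuous_intros)
    show "\<bar>f (x - t)\<bar> \<le> B" for t x using bd by blast
    fix x :: real
    have le: "\<bar>f (x - t)\<bar> \<le> B * indicator {x - b..x - b + b} t" for t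
      using fle[of "x - t"] by (auto simp: indicator_def split: if_splits)
    show "integrable halfline (\<lambda>t. f (x - t))" "(\<integral>t. \<bar>f (x - t)\<bar> \<partial>halfline) \<le> B * b"
      by (rule interval_kernel_integral[OF _ b B le], intro cont' continuous_intros)+
  qed
  \<comment> \<open>The translation semigroup treats negative times as \<open>0\<close>.\<close>
  have eq: "translation t (abs_ae_fun f) = abs_ae_fun (\<lambda>x. f (x + max 0 t))" for t
    using meas by (simp add: translation.abs_eq ae_eq_refl_iff)
  have "Pettis_integrable V N (\<lambda>t. abs_ae_fun (\<lambda>x. f (x + max 0 t)))"
  proof (rule Pettis_integrable_kernel[where K = "\<lambda>t x. f (x + max 0 t)" and B = B and C = "B * b"])
    show "continuous_on UNIV (\<lambda>t. f (x + max 0 t))" for x by (intro cont' continuous_intros)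
    show "(\<lambda>x. f (x + max 0 t)) \<in> borel_measurable halfline" for t
      by (intro continuous_measurable_halfline cont' continuous_intros)
    show "\<bar>f (x + max 0 t)\<bar> \<le> B" for t x using bd by blast
    fix x :: real
    have le: "\<bar>f (x + max 0 t)\<bar> \<le> B * indicator {- x..- x + b} t" if "0 \<le> t" for t
      using fle[of "x + t"] that by (auto simp: indicator_def split: if_splits)
    show "integrable halfline (\<lambda>t. f (x + max 0 t))" "(\<integral>t. \<bar>f (x + max 0 t)\<bar> \<partial>halfline) \<le> B * b"
      by (rule interval_kernel_integral[OF _ b B le], intro cont' continuous_intros, assumption)+
  qed
  then show "Pettis_integrable V N (\<lambda>t. translation t (abs_ae_fun f))"
    by (simp add: eq)
qed

text \<open>
  The maps of the criterion act on classes, so a continuous representative has to be chosen before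
  it is translated to the right. The values of the representative at negative points, which become
  visible, are zero.
\<close>

lemma frequent_hypercyclicity_criterion_translation:
  "frequent_hypercyclicity_criterion V N translation"
proof -
  define rep where "rep u = (SOME f. f \<in> test_functions \<and> u = abs_ae_fun f)" for u
  define S where "S t u = abs_ae_fun (\<lambda>x. rep u (x - t))" for t u
  let ?X0 = "abs_ae_fun ` test_functions"
  have rep: "rep u \<in> test_functions" "u = abs_ae_fun (rep u)" if "u \<in> ?X0" for u
  proof -
    have "\<exists>f. f \<in> test_functions \<and> u = abs_ae_fun f" using that by blast
    from someI_ex[OF this] show "rep u \<in> test_functions" "u = abs_ae_fun (rep u)"
      unfolding rep_def by auto
  qed
  have meas: "(\<lambda>x. rep u (x - r)) \<in> borel_measurable halfline" if "u \<in> ?X0" for u r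
  proof (rule continuous_measurable_halfline)
    have "continuous_on UNIV (rep u)" using rep(1)[OF that] by (simp add: test_functions_def)
    then show "continuous_on UNIV (\<lambda>x. rep u (x - r))"
      by (rule continuous_on_compose2) (auto intro: continuous_intros)
  qed
  have TS: "translation t (S r u) = abs_ae_fun (\<lambda>x. rep u (x + t - r))" if "u \<in> ?X0" "0 < t" for t r u
    using translation_abs[OF meas[OF that(1)], of t r] that(2) by (simp add: S_def)
  have PT: "Pettis_integrable V N (\<lambda>t. translation t u)" and PS: "Pettis_integrable V N (\<lambda>t. S t u)"
    if "u \<in> ?X0" for u
    using Pettis_integrable_test_function[OF rep(1)[OF that]] rep(2)[OF that] by (simp_all add: S_def)
  show ?thesis
    unfolding frequent_hypercyclicity_criterion_def
  proof (intro exI[of _ ?X0] exI[of _ S] conjI ballI allI impI)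
    show "dense_subset V N ?X0" by (rule dense_test_functions)
    show "S t u \<in> V" if "0 < t" "u \<in> ?X0" for t u
      using PS[OF that(2)] that(1) by (simp add: Pettis_integrable_def)
    show "translation t (S t u) = u" if "u \<in> ?X0" "0 < t" for t u
      using TS[OF that] rep(2)[OF that(1)] by simp
    show "translation t (S r u) = S (r - t) u" if "u \<in> ?X0" "0 < t" "t < r" for t r u
    proof -
      have "x - (r - t) = x + t - r" for x by simp
      then show ?thesis by (simp only: TS[OF that(1,2)]) (simp only: S_def)
    qed
  qed (fact PT PS)+
qed


end


section \<open>Chaos for an integrable weight\<close>

text \<open>
  The step function with mesh \<open>1 / (m + 1)\<close> whose consecutive values are the entries of the list.
  It is used on the half-line only; the rounding to natural numbers extends its first value to the
  negative half-line. There are countably many such functions.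
\<close>

definition step_block :: "nat \<Rightarrow> rat list \<Rightarrow> real \<Rightarrow> real" where
  "step_block m qs x = (let k = nat \<lfloor>real (Suc m) * x\<rfloor> in if k < length qs then of_rat (qs ! k) else 0)"

lemma step_block_measurable: "step_block m qs \<in> borel_measurable borel"
proof -
  have "(\<lambda>x. nat \<lfloor>real (Suc m) * x\<rfloor>) \<in> borel \<rightarrow>\<^sub>M count_space UNIV" by measurable
  from measurable_compose[OF this, of "\<lambda>k. if k < length qs then of_rat (qs ! k) else 0" borel]
  show ?thesis by (simp add: step_block_def[abs_def] Let_def)
qed

lemma step_block_bounded: "\<exists>B. \<forall>x. \<bar>step_block m qs x\<bar> \<le> B"
proof (intro exI allI)
  fix x
  show "\<bar>step_block m qs x\<bar> \<le> (\<Sum>k<length qs. \<bar>of_rat (qs ! k)\<bar>)"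
    using member_le_sum[of "nat \<lfloor>real (Suc m) * x\<rfloor>" "{..<length qs}" "\<lambda>k. \<bar>of_rat (qs ! k)\<bar> :: real"]
    by (auto simp: step_block_def Let_def sum_nonneg)
qed

lemma step_block_support: "\<exists>b. \<forall>x\<ge>b. step_block m qs x = 0"
proof (intro exI allI impI)
  fix x :: real assume x: "real (length qs) \<le> x"
  then have "1 * x \<le> real (Suc m) * x" by (intro mult_right_mono) auto
  then have "int (length qs) \<le> \<lfloor>real (Suc m) * x\<rfloor>" using x by (simp add: le_floor_iff)
  then show "step_block m qs x = 0" by (simp add: step_block_def Let_def)
qed

lemma step_block_approximation:
  assumes f: "f \<in> test_functions" and \<epsilon>: "0 < \<epsilon>"
  shows "\<exists>m qs. \<forall>x\<ge>0. \<bar>f x - step_block m qs x\<bar> \<le> \<epsilon>"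
proof -
  obtain b where b: "0 \<le> b" "\<forall>x. x \<notin> {0..b} \<longrightarrow> f x = 0"
    using test_function_bounds[OF f] by iprover
  define c where "c = Suc (nat \<lceil>b\<rceil>)"
  have c: "b < real c" using real_nat_ceiling_ge[of b] by (simp add: c_def)
  have "uniformly_continuous_on {0..real c} f"
  proof (rule compact_uniformly_continuous)
    show "continuous_on {0..real c} f"
      by (rule continuous_on_subset[of UNIV]) (use f in \<open>auto simp: test_functions_def\<close>)
  qed simp
  then have "\<exists>\<delta>>0. \<forall>y\<in>{0..real c}. \<forall>x\<in>{0..real c}. dist x y < \<delta> \<longrightarrow> dist (f x) (f y) < \<epsilon> / 2"
    using half_gt_zero[OF \<epsilon>] unfolding uniformly_continuous_on_def by blast
  then obtain \<delta> where \<delta>: "0 < \<delta>"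
    "\<forall>y\<in>{0..real c}. \<forall>x\<in>{0..real c}. dist x y < \<delta> \<longrightarrow> dist (f x) (f y) < \<epsilon> / 2"
    by iprover
  obtain m where m: "inverse (real (Suc m)) < \<delta>" using reals_Archimedean[OF \<delta>(1)] by blast
  have "\<exists>q. \<bar>f (real k / real (Suc m)) - of_rat q\<bar> < \<epsilon> / 2" for k
  proof -
    obtain q where "f (real k / real (Suc m)) - \<epsilon> / 2 < of_rat q" "of_rat q < f (real k / real (Suc m))"
      using of_rat_dense[of "f (real k / real (Suc m)) - \<epsilon> / 2" "f (real k / real (Suc m))"] \<epsilon> by auto
    then show ?thesis by (intro exI[of _ q]) (simp add: abs_if)
  qed
  then obtain q where q: "\<And>k. \<bar>f (real k / real (Suc m)) - of_rat (q k)\<bar> < \<epsilon> / 2" by metis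
  define n where "n = Suc m * c"
  have "\<bar>f x - step_block m (map q [0..<n]) x\<bar> \<le> \<epsilon>" if x: "0 \<le> x" for x
  proof -
    define k where "k = nat \<lfloor>real (Suc m) * x\<rfloor>"
    have "0 \<le> real (Suc m) * x" using x by simp
    then have "real k = of_int \<lfloor>real (Suc m) * x\<rfloor>" by (simp add: k_def)
    then have k: "real k \<le> real (Suc m) * x" "real (Suc m) * x < real k + 1" by linarith+
    then have kx: "real k / real (Suc m) \<le> x" "x - real k / real (Suc m) < inverse (real (Suc m))"
    proof -
      show "real k / real (Suc m) \<le> x" using k(1) by (simp add: pos_divide_le_eq mult.commute del: of_nat_Suc)
      have "x < (real k + 1) / real (Suc m)" using k(2) by (simp add: pos_less_divide_eq mult.commute del: of_nat_Suc)
      then show "x - real k / real (Suc m) < inverse (real (Suc m))"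
        by (simp add: add_divide_distrib inverse_eq_divide del: of_nat_Suc)
    qed
    have step: "step_block m (map q [0..<n]) x = (if k < n then of_rat (q k) else 0)"
      by (simp add: step_block_def Let_def k_def del: of_nat_Suc)
    show ?thesis
    proof (cases "x < real c")
      case True
      then have "real (Suc m) * x < real (Suc m) * real c" by (intro mult_strict_left_mono) auto
      then have "real k < real n" using k(1) unfolding n_def of_nat_mult by linarith
      then have "k < n" by simp
      moreover have "\<bar>f x - f (real k / real (Suc m))\<bar> < \<epsilon> / 2"
      proof -
        have "dist x (real k / real (Suc m)) < \<delta>" using kx m by (simp add: dist_real_def del: of_nat_Suc)
        then show ?thesis
          using \<delta>(2)[rule_format, of "real k / real (Suc m)" x] kx(1) x True
          by (simp add: dist_real_def del: of_nat_Suc)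
      qed
      ultimately show ?thesis using q[of k] unfolding step by (simp only: if_True)
    next
      case False
      then have "f x = 0" using b c by auto
      have "real (Suc m) * real c \<le> real (Suc m) * x" using False by (intro mult_left_mono) auto
      then have "real n < real k + 1" using k(2) unfolding n_def of_nat_mult by linarith
      then have "\<not> k < n" by linarith
      then show ?thesis using \<epsilon> \<open>f x = 0\<close> by (simp add: step)
    qed
  qed
  then show ?thesis by blast
qed

context integrable_weight_Lp
begin

text \<open>
  The periodic continuation of \<open>f\<close> from \<open>[0, n + 1[\<close> agrees with \<open>f\<close> on that interval and has the same
  bound.
\<close>

lemma dense_periodic_points: "dense_subset V N (periodic_points V translation)"
  unfolding dense_subset_iff
proof (intro conjI ballI allI impI)
  show "periodic_points V translation \<subseteq> V" by (auto simp: periodic_points_def)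
  fix u and e :: real assume u: "u \<in> V" and e: "0 < e"
  obtain f where f: "f \<in> test_functions" "N (u - abs_ae_fun f) < e / 2"
    using dense_test_functions u half_gt_zero[OF e] unfolding dense_subset_iff by blast
  obtain B where bd: "\<forall>x. \<bar>f x\<bar> \<le> B"
    using test_function_bounds[OF f(1)] by iprover
  have cont: "continuous_on UNIV f" using f by (simp add: test_functions_def)
  define g where "g n x = f (x - real (Suc n) * of_int \<lfloor>x / real (Suc n)\<rfloor>)" for n x
  have f_meas: "f \<in> borel_measurable halfline" by (rule continuous_measurable_halfline[OF cont])
  have g_meas: "g n \<in> borel_measurable halfline" for n
  proof -
    have [measurable]: "f \<in> borel_measurable borel" using cont by (rule borel_measurable_continuous_onI)
    have "g n \<in> borel_measurable borel" unfolding g_def by measurable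
    then show ?thesis by (intro measurable_restrict_space1 measurable_completion) simp
  qed
  have gB: "\<bar>g n x\<bar> \<le> B" for n x using bd by (simp add: g_def)
  have gV: "abs_ae_fun (g n) \<in> V" for n by (rule bounded_in_V(1)[OF g_meas gB])
  have fV: "abs_ae_fun f \<in> V" by (rule bounded_in_V(1)[OF f_meas]) (use bd in blast)
  have per: "abs_ae_fun (g n) \<in> periodic_points V translation" for n
  proof -
    have "g n (x + real (Suc n)) = g n x" for x
    proof -
      have "(x + real (Suc n)) / real (Suc n) = x / real (Suc n) + 1"
        by (simp add: add_divide_distrib del: of_nat_Suc)
      then have "\<lfloor>(x + real (Suc n)) / real (Suc n)\<rfloor> = \<lfloor>x / real (Suc n)\<rfloor> + 1" by simp
      then show ?thesis by (simp add: g_def algebra_simps del: of_nat_Suc)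
    qed
    then have "translation (real (Suc n)) (abs_ae_fun (g n)) = abs_ae_fun (g n)"
      using translation_abs[OF g_meas, of "real (Suc n)" n] by simp
    then show ?thesis
      using gV unfolding periodic_points_def by (intro CollectI conjI exI[of _ "real (Suc n)"]) auto
  qed
  have "(\<lambda>n. N (abs_ae_fun (g n) - abs_ae_fun f)) \<longlonglongrightarrow> 0"
  proof (rule bounded_convergence[where f = g and B = B])
    show "AE x in halfline. (\<lambda>n. g n x) \<longlonglongrightarrow> f x"
    proof (rule AE_I2)
      fix x :: real assume "x \<in> space halfline"
      then have x: "0 \<le> x" by simp
      show "(\<lambda>n. g n x) \<longlonglongrightarrow> f x"
      proof (rule tendsto_eventually, use eventually_ge_at_top[of "nat \<lceil>x\<rceil>"] in eventually_elim)
        case (elim n)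
        then have "x < real (Suc n)" using real_nat_ceiling_ge[of x] by linarith
        then have "\<lfloor>x / real (Suc n)\<rfloor> = 0" using x by (intro floor_unique) auto
        then show ?case by (simp add: g_def)
      qed
    qed
  qed (use bd f_meas g_meas gB in auto)
  then obtain n where n: "N (abs_ae_fun (g n) - abs_ae_fun f) < e / 2"
    using eventually_happens'[OF sequentially_bot order_tendstoD(2)[OF _ half_gt_zero[OF e]]] by blast
  have "N (u - abs_ae_fun (g n)) < e"
    using triangle[OF u fV gV[of n]] f(2) n commute[of "abs_ae_fun f" "abs_ae_fun (g n)"] by linarith
  then show "\<exists>v\<in>periodic_points V translation. N (u - v) < e"
    using per by blast
qed

lemma weight_tail_tendsto_0:
  "(\<lambda>n. \<integral>t. indicator {real n..} t * \<rho> t \<partial>halfline) \<longlonglongrightarrow> 0"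
proof -
  have "(\<lambda>n. \<integral>t. indicator {real n..} t * \<rho> t \<partial>halfline) \<longlonglongrightarrow> (\<integral>t. 0 \<partial>halfline)"
  proof (rule integral_dominated_convergence[OF _ _ weight_integrable])
    show "(\<lambda>t. indicator {real n..} t * \<rho> t) \<in> borel_measurable halfline" for n
      by (intro borel_measurable_times weight_measurable measurable_restrict_space1 borel_measurable_indicator) simp
    show "AE t in halfline. norm (indicator {real n..} t * \<rho> t) \<le> \<rho> t" for n
    proof (rule AE_I2)
      fix t :: real assume "t \<in> space halfline"
      then show "norm (indicator {real n..} t * \<rho> t) \<le> \<rho> t"
        using weight_pos[of t] by (auto simp: indicator_def)
    qed
    show "AE t in halfline. (\<lambda>n. indicator {real n..} t * \<rho> t) \<longlonglongrightarrow> 0"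
    proof (intro AE_I2 tendsto_eventually)
      fix t :: real
      show "\<forall>\<^sub>F n in sequentially. indicator {real n..} t * \<rho> t = 0"
        using eventually_gt_at_top[of "nat \<lceil>t\<rceil>"]
      proof eventually_elim
        case (elim n)
        then have "t < real n" using real_nat_ceiling_ge[of t] by linarith
        then show ?case by (simp add: indicator_def)
      qed
    qed
  qed simp
  then show ?thesis by simp
qed

text \<open>
  The blocks \<open>g\<^sub>0, g\<^sub>1, \<dots>\<close> are placed one after the other along the half-line, with gaps so large
  that once the orbit has moved the block \<open>g\<^sub>k\<close> to the origin, all later blocks together weigh at
  most \<open>2\<^sup>-\<^sup>k\<close>.
\<close>

lemma hypercyclic_if_dense_blocks:
  fixes g :: "nat \<Rightarrow> real \<Rightarrow> real"
  assumes g_meas: "\<And>j. g j \<in> borel_measurable borel"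
    and bd: "\<And>j. \<exists>B. \<forall>x. \<bar>g j x\<bar> \<le> B"
    and supp: "\<And>j. \<exists>b. \<forall>x\<ge>b. g j x = 0"
    and dense: "\<And>u e k. u \<in> V \<Longrightarrow> 0 < e \<Longrightarrow> \<exists>j\<ge>k. N (u - abs_ae_fun (g j)) < e"
  shows "hypercyclic V N translation"
proof -
  obtain B where B: "\<And>j x. \<bar>g j x\<bar> \<le> B j" using bd by metis
  obtain b where b: "\<And>j x. b j \<le> x \<Longrightarrow> g j x = 0" using supp by metis
  have B0: "0 \<le> B j" for j using B[of j 0] by linarith
  define tail where "tail r = (\<integral>t. indicator {r..} t * \<rho> t \<partial>halfline)" for r
  \<comment> \<open>The gap between the starts of the blocks \<open>j\<close> and \<open>j + 1\<close> has to leave room for block \<open>j\<close> and to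
      make block \<open>j + 1\<close> light while block \<open>j\<close> or an earlier one is at the origin.\<close>
  have "\<exists>d::nat. 1 \<le> d \<and> b j \<le> real d \<and> B (Suc j) powr p * tail (real d) < (1 / 2) ^ Suc j" for j
  proof -
    have "(\<lambda>n. B (Suc j) powr p * tail (real n)) \<longlonglongrightarrow> 0"
      unfolding tail_def using tendsto_mult_right_zero[OF weight_tail_tendsto_0] by simp
    then have "\<forall>\<^sub>F n in sequentially. B (Suc j) powr p * tail (real n) < (1 / 2) ^ Suc j"
      by (rule order_tendstoD(2)) simp
    moreover have "\<forall>\<^sub>F n in sequentially. 1 \<le> n \<and> nat \<lceil>b j\<rceil> \<le> n"
      by (intro eventually_conj eventually_ge_at_top)
    ultimately have "\<forall>\<^sub>F n in sequentially. 1 \<le> n \<and> b j \<le> real n \<and> B (Suc j) powr p * tail (real n) < (1 / 2) ^ Suc j"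
    proof eventually_elim
      case (elim n)
      then show ?case using real_nat_ceiling_ge[of "b j"] by linarith
    qed
    then show ?thesis using eventually_happens'[OF sequentially_bot] by blast
  qed
  then obtain d :: "nat \<Rightarrow> nat" where d: "\<And>j. 1 \<le> d j" "\<And>j. b j \<le> real (d j)"
    "\<And>j. B (Suc j) powr p * tail (real (d j)) < (1 / 2) ^ Suc j"
    by metis
  define t where "t j = real (\<Sum>i<j. d i)" for j
  have t0: "t 0 = 0" and t_Suc: "t (Suc j) = t j + real (d j)" for j by (simp_all add: t_def)
  have t_mono: "t i \<le> t j" if "i \<le> j" for i j
    unfolding t_def using that by (intro of_nat_mono sum_mono2) auto
  have t_nonneg: "0 \<le> t j" for j by (simp add: t_def sum_nonneg)
  have t_ge: "real j \<le> t j" for j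
  proof (induction j)
    case (Suc j)
    then show ?case using d(1)[of j] by (simp add: t_Suc)
  qed (simp add: t0)
  \<comment> \<open>The index of the block whose interval \<open>[t\<^sub>j, t\<^sub>j\<^sub>+\<^sub>1[\<close> contains \<open>x\<close>.\<close>
  define idx where "idx x = (LEAST j. x < t (Suc j))" for x
  have idx_less: "x < t (Suc (idx x))" for x
  proof -
    have "x < t (Suc (nat \<lceil>x\<rceil>))"
      using t_ge[of "Suc (nat \<lceil>x\<rceil>)"] real_nat_ceiling_ge[of x] by linarith
    then show ?thesis unfolding idx_def by (rule LeastI)
  qed
  have idx_le: "t (idx x) \<le> x" if "0 \<le> x" for x
  proof (cases "idx x")
    case 0
    then show ?thesis using that t0 by simp
  next
    case (Suc j)
    then have "\<not> x < t (Suc j)" unfolding idx_def by (intro not_less_Least) simp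
    then show ?thesis using Suc by simp
  qed
  define w where "w x = g (idx x) (x - t (idx x))" for x
  have w_meas: "w \<in> borel_measurable halfline"
  proof -
    have [measurable]: "idx \<in> borel \<rightarrow>\<^sub>M count_space UNIV"
      unfolding idx_def by measurable
    have "(\<lambda>x. g (idx x) (x - t (idx x))) \<in> borel_measurable borel"
    proof (rule measurable_compose_countable[where f = "\<lambda>j x. g j (x - t j)" and g = idx])
      show "(\<lambda>x. g j (x - t j)) \<in> borel_measurable borel" for j
        using g_meas[of j] by measurable
    qed measurable
    then show ?thesis
      unfolding w_def by (intro measurable_restrict_space1 measurable_completion) simp
  qed
  have g_meas': "g j \<in> borel_measurable halfline" for j
    using g_meas[of j] by (intro measurable_restrict_space1 measurable_completion) simp
  have gV: "abs_ae_fun (g j) \<in> V" for j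
    by (rule bounded_in_V(1)[OF g_meas' B])
  have key: "\<bar>w (x + t k) - g k x\<bar> powr p * \<rho> x = 0 \<or>
      (\<exists>i. \<bar>w (x + t k) - g k x\<bar> powr p * \<rho> x \<le> B (Suc (k + i)) powr p * (indicator {real (d (k + i))..} x * \<rho> x))"
    if x: "0 \<le> x" for k x
  proof -
    define j where "j = idx (x + t k)"
    have j: "t j \<le> x + t k" "x + t k < t (Suc j)"
      unfolding j_def using idx_le[of "x + t k"] idx_less[of "x + t k"] x t_nonneg[of k] by auto
    have "k \<le> j"
    proof (rule ccontr)
      assume "\<not> k \<le> j"
      then have "t (Suc j) \<le> t k" by (intro t_mono) simp
      then show False using j(2) x by simp
    qed
    show ?thesis
    proof (cases "j = k")
      case True
      then have "w (x + t k) = g k x" by (simp add: w_def flip: j_def)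
      then show ?thesis by simp
    next
      case False
      then obtain i where i: "j = Suc (k + i)"
        using \<open>k \<le> j\<close> less_imp_Suc_add[of k j] by auto
      have "t (Suc k) \<le> t j" by (rule t_mono) (simp add: i)
      then have "b k \<le> x" using j(1) d(2)[of k] by (simp add: t_Suc)
      then have "g k x = 0" by (rule b)
      then have "\<bar>w (x + t k) - g k x\<bar> \<le> B j"
        using B[of j "x + t k - t j"] by (simp add: w_def flip: j_def)
      then have "\<bar>w (x + t k) - g k x\<bar> powr p * \<rho> x \<le> B j powr p * \<rho> x"
        using weight_pos[OF x] one_le_p by (intro mult_right_mono powr_mono2) auto
      moreover have "t k \<le> t (k + i)" by (rule t_mono) simp
      then have "real (d (k + i)) \<le> x" using j(1) by (simp add: i t_Suc)
      ultimately show ?thesis by (intro disjI2 exI[of _ i]) (simp add: i)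
    qed
  qed
  have close: "abs_ae_fun (\<lambda>x. w (x + t k) - g k x) \<in> V
      \<and> N (abs_ae_fun (\<lambda>x. w (x + t k) - g k x)) \<le> ((1 / 2) ^ k) powr (1 / p)" for k
  proof -
    let ?F = "\<lambda>x. \<bar>w (x + t k) - g k x\<bar> powr p * \<rho> x"
    let ?G = "\<lambda>i x. B (Suc (k + i)) powr p * (indicator {real (d (k + i))..} x * \<rho> x)"
    have diff_meas: "(\<lambda>x. w (x + t k) - g k x) \<in> borel_measurable halfline"
      using translate_measurable[OF w_meas t_nonneg[of k]] g_meas' by (intro borel_measurable_diff)
    have F_meas: "?F \<in> borel_measurable halfline"
      using diff_meas weight_measurable by measurable
    have F_nonneg: "0 \<le> ?F x" if "0 \<le> x" for x using weight_pos[OF that] by simp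
    have G_meas: "?G i \<in> borel_measurable halfline" for i
      by (intro borel_measurable_times borel_measurable_const weight_measurable
          measurable_restrict_space1 borel_measurable_indicator) simp
    have G_int: "integrable halfline (?G i)" for i
    proof (rule integrable_mult_right, rule Bochner_Integration.integrable_bound[OF weight_integrable])
      show "(\<lambda>x. indicator {real (d (k + i))..} x * \<rho> x) \<in> borel_measurable halfline"
        by (intro borel_measurable_times weight_measurable measurable_restrict_space1 borel_measurable_indicator) simp
    qed (auto intro!: AE_I2 simp: indicator_def)
    have G_nonneg: "0 \<le> ?G i x" if "0 \<le> x" for i x using weight_pos[OF that] by (simp add: less_imp_le)
    have "(\<integral>\<^sup>+ x. ennreal (?F x) \<partial>halfline) \<le> (\<integral>\<^sup>+ x. (\<Sum>i. ennreal (?G i x)) \<partial>halfline)"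
    proof (rule nn_integral_mono)
      fix x :: real assume "x \<in> space halfline"
      then have x: "0 \<le> x" by simp
      from key[OF x, of k] show "ennreal (?F x) \<le> (\<Sum>i. ennreal (?G i x))"
      proof (elim disjE exE)
        fix i assume "?F x \<le> ?G i x"
        then have "ennreal (?F x) \<le> ennreal (?G i x)" by (rule ennreal_leI)
        also have "\<dots> \<le> (\<Sum>i. ennreal (?G i x))"
          using sum_le_suminf[of "\<lambda>i. ennreal (?G i x)" "{i}"] by (simp add: summableI)
        finally show ?thesis .
      next
        assume "?F x = 0"
        then show ?thesis by (simp only: ennreal_0 zero_le)
      qed
    qed
    also have "\<dots> = (\<Sum>i. (\<integral>\<^sup>+ x. ennreal (?G i x) \<partial>halfline))"
      using G_meas by (intro nn_integral_suminf measurable_compose[OF _ measurable_ennreal])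
    also have "\<dots> \<le> (\<Sum>i. ennreal ((1 / 2) ^ Suc (k + i)))"
    proof (rule suminf_le[OF _ summableI summableI])
      fix i
      have "(\<integral>\<^sup>+ x. ennreal (?G i x) \<partial>halfline) = ennreal (\<integral>x. ?G i x \<partial>halfline)"
        using G_int G_nonneg by (intro nn_integral_eq_integral AE_I2) auto
      also have "(\<integral>x. ?G i x \<partial>halfline) = B (Suc (k + i)) powr p * tail (real (d (k + i)))"
        by (simp add: tail_def)
      finally show "(\<integral>\<^sup>+ x. ennreal (?G i x) \<partial>halfline) \<le> ennreal ((1 / 2) ^ Suc (k + i))"
        using d(3)[of "k + i"] by (simp add: ennreal_leI less_imp_le)
    qed
    also have "\<dots> = ennreal ((1 / 2) ^ k)"
    proof (rule suminf_ennreal_eq)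
      have "(\<lambda>i. (1 / 2) ^ k * (1 / 2) ^ Suc i) sums ((1 / 2) ^ k * (1::real))"
        by (intro sums_mult power_half_series)
      then show "(\<lambda>i. (1 / 2) ^ Suc (k + i)) sums ((1 / 2) ^ k :: real)"
        by (simp add: power_add mult_ac)
    qed simp
    finally have F_le: "(\<integral>\<^sup>+ x. ennreal (?F x) \<partial>halfline) \<le> ennreal ((1 / 2) ^ k)" .
    have F_int: "integrable halfline ?F"
      using F_meas F_nonneg order.strict_trans1[OF F_le ennreal_less_top]
      by (intro integrableI_nonneg AE_I2) auto
    have "(\<integral>\<^sup>+ x. ennreal (?F x) \<partial>halfline) = ennreal (\<integral>x. ?F x \<partial>halfline)"
      by (rule nn_integral_eq_integral[OF F_int], rule AE_I2, rule F_nonneg, simp)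
    with F_le have "ennreal (\<integral>x. ?F x \<partial>halfline) \<le> ennreal ((1 / 2) ^ k)"
      by (simp only:)
    then have "(\<integral>x. ?F x \<partial>halfline) \<le> (1 / 2) ^ k" by (simp add: ennreal_le_iff)
    moreover have "0 \<le> (\<integral>x. ?F x \<partial>halfline)"
      using F_nonneg by (intro integral_nonneg_AE AE_I2) auto
    ultimately have "(\<integral>x. ?F x \<partial>halfline) powr (1 / p) \<le> ((1 / 2) ^ k) powr (1 / p)"
      using one_le_p by (intro powr_mono2) auto
    then show ?thesis
      using F_int diff_meas by (simp add: Lp_abs_iff Lp_norm_abs)
  qed
  define W where "W = abs_ae_fun w"
  have TW: "translation (t k) W - abs_ae_fun (g k) = abs_ae_fun (\<lambda>x. w (x + t k) - g k x)" for k
    using translate_measurable[OF w_meas t_nonneg[of k]] g_meas'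
    by (simp add: W_def translation_abs[OF w_meas t_nonneg] abs_ae_fun_linear)
  \<comment> \<open>The estimate for \<open>k = 0\<close> compares \<open>w\<close> itself with the first block.\<close>
  have W_V: "W \<in> V"
  proof -
    have "translation (t 0) W - abs_ae_fun (g 0) \<in> V" using close[of 0] by (simp only: TW)
    then have "translation (t 0) W - abs_ae_fun (g 0) + abs_ae_fun (g 0) \<in> V" using gV by (rule V_add)
    then show ?thesis using w_meas by (simp add: t0 W_def translation_abs)
  qed
  have TV: "translation s W \<in> V" if "0 \<le> s" for s
    by (rule translation_in_Lp[OF admissible W_V that])
  show ?thesis
    unfolding hypercyclic_def
  proof (rule bexI[OF _ W_V], unfold dense_subset_iff, intro conjI ballI allI impI)
    show "{translation s W |s. 0 \<le> s} \<subseteq> V" using TV by auto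
    fix u and e :: real assume u: "u \<in> V" and e: "0 < e"
    have "(\<lambda>k. ((1 / 2) ^ k) powr (1 / p)) \<longlonglongrightarrow> 0 powr (1 / p)"
      using one_le_p by (intro tendsto_powr2[OF _ tendsto_const] LIMSEQ_power_zero) auto
    then have "\<forall>\<^sub>F k in sequentially. ((1 / 2) ^ k) powr (1 / p) < e / 2"
      using e by (intro order_tendstoD(2)) auto
    then obtain k0 where k0: "\<And>k. k0 \<le> k \<Longrightarrow> ((1 / 2) ^ k) powr (1 / p) < e / 2"
      by (auto simp: eventually_sequentially)
    obtain k where k: "k0 \<le> k" "N (u - abs_ae_fun (g k)) < e / 2"
      using dense[OF u half_gt_zero[OF e], of k0] by blast
    have "N (translation (t k) W - abs_ae_fun (g k)) < e / 2"
      using close[of k] k0[OF k(1)] unfolding TW by linarith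
    then have "N (u - translation (t k) W) < e"
      using triangle[OF u gV TV[OF t_nonneg], of k k] k(2) commute[of "abs_ae_fun (g k)" "translation (t k) W"] by linarith
    then show "\<exists>v\<in>{translation s W |s. 0 \<le> s}. N (u - v) < e"
      using t_nonneg[of k] by blast
  qed
qed

text \<open>
  The blocks enumerate triples rather than pairs of a mesh and a list, so that each step function
  occurs for infinitely many indices and can be met arbitrarily late.
\<close>

lemma hypercyclic_translation: "hypercyclic V N translation"
proof -
  define g where "g j = (case from_nat j of (m, qs, _ :: nat) \<Rightarrow> step_block m qs)" for j
  show ?thesis
  proof (rule hypercyclic_if_dense_blocks[of g])
    show "g j \<in> borel_measurable borel" for j
      by (simp add: g_def step_block_measurable split: prod.split)
    show "\<exists>B. \<forall>x. \<bar>g j x\<bar> \<le> B" for j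
      using step_block_bounded by (simp add: g_def split: prod.split)
    show "\<exists>b. \<forall>x\<ge>b. g j x = 0" for j
      using step_block_support by (simp add: g_def split: prod.split)
    fix u and e :: real and k assume u: "u \<in> V" and e: "0 < e"
    obtain f where f: "f \<in> test_functions" "N (u - abs_ae_fun f) < e / 2"
      using dense_test_functions u half_gt_zero[OF e] unfolding dense_subset_iff by blast
    define R where "R = (integral\<^sup>L halfline \<rho>) powr (1 / p)"
    have R: "0 \<le> R" by (simp add: R_def)
    define \<epsilon> where "\<epsilon> = e / (2 * (R + 1))"
    have \<epsilon>: "0 < \<epsilon>" "\<epsilon> * R < e / 2" using e R by (simp_all add: \<epsilon>_def field_simps)
    obtain m qs where mq: "\<And>x. 0 \<le> x \<Longrightarrow> \<bar>f x - step_block m qs x\<bar> \<le> \<epsilon>"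
      using step_block_approximation[OF f(1) \<epsilon>(1)] by blast
    have "inj (\<lambda>i::nat. to_nat (m, qs, i))" by (simp add: inj_on_def)
    then have "infinite (range (\<lambda>i::nat. to_nat (m, qs, i)))" by (rule range_inj_infinite)
    then obtain i :: nat where i: "k \<le> to_nat (m, qs, i)"
      unfolding infinite_nat_iff_unbounded_le by blast
    have g: "g (to_nat (m, qs, i)) = step_block m qs" by (simp add: g_def)
    have f_meas: "f \<in> borel_measurable halfline"
      using f(1) by (intro continuous_measurable_halfline) (simp add: test_functions_def)
    have s_meas: "step_block m qs \<in> borel_measurable halfline"
      by (intro measurable_restrict_space1 measurable_completion) (simp add: step_block_measurable)
    have fV: "abs_ae_fun f \<in> V" using f(1) dense_test_functions unfolding dense_subset_iff by blast
    obtain B where B: "\<forall>x. \<bar>step_block m qs x\<bar> \<le> B" using step_block_bounded by iprover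
    have sV: "abs_ae_fun (step_block m qs) \<in> V"
      by (rule bounded_in_V(1)[OF s_meas, of B]) (use B in simp)
    have "(\<lambda>x. f x - step_block m qs x) \<in> borel_measurable halfline"
      using f_meas s_meas by (rule borel_measurable_diff)
    from bounded_in_V(2)[OF this mq] have "N (abs_ae_fun f - abs_ae_fun (step_block m qs)) \<le> \<epsilon> * R"
      using f_meas s_meas by (simp add: abs_ae_fun_linear R_def)
    then have "N (u - abs_ae_fun (step_block m qs)) < e"
      using triangle[OF u fV sV] f(2) \<epsilon>(2) by linarith
    then show "\<exists>j\<ge>k. N (u - abs_ae_fun (g j)) < e"
      using i g by (intro exI[of _ "to_nat (m, qs, i)"]) simp
  qed
qed

lemma chaotic_translation: "chaotic V N translation"
  unfolding chaotic_def using hypercyclic_translation dense_periodic_points by blast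

end


section \<open>The equivalence\<close>

theorem proposition3p3:
  fixes \<rho> :: "real \<Rightarrow> real" and p :: real
  assumes "admissible_weight \<rho>" and "1 \<le> p"
  shows "chaotic (Lp p \<rho>) (Lp_norm p \<rho>) translation \<longleftrightarrow>
    frequent_hypercyclicity_criterion (Lp p \<rho>) (Lp_norm p \<rho>) translation"
proof -
  interpret admissible_Lp \<rho> p
    using assms by unfold_locales (simp_all add: admissible_weight_def)
  show ?thesis
  proof (cases "integrable halfline \<rho>")
    case True
    then interpret integrable_weight_Lp \<rho> p
      by unfold_locales
    show ?thesis
      using chaotic_translation frequent_hypercyclicity_criterion_translation by blast
  next
    case False
    then show ?thesis
      using chaotic_imp_integrable_weight frequent_hypercyclicity_criterion_imp_integrable_weight
      by blast
  qed
qed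

end
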